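(* Let $(\chi,\Psi)$ be a scattering filter bank on $\mathbb{R}^d$, with $\Psi=(\psi_\lambda)_{\lambda\in\Lambda}$. Then $(\chi,\Psi)$ is admissible; that is, for every $f\in L^2(\mathbb{R}^d)$, $$\lim_{N\to\infty}\|U_Nf\|_{\ell^2(\Lambda^N;L^2(\mathbb{R}^d))}=0.$$ Consequently, for every $f\in L^2(\mathbb{R}^d)$, $$\|\mathsf{S}_\chi f\|_{\ell^2(\Lambda^\ast;L^2(\mathbb{R}^d))}^2=\sum_{n=0}^\infty\sum_{p\in\Lambda^n}\|\mathsf{S}_\chi[p]f\|_2^2=\|f\|_2^2,$$ so $\mathsf{S}_\chi$ is norm-preserving from $L^2(\mathbb{R}^d)$ into $\ell^2(\Lambda^\ast;L^2(\mathbb{R}^d))$.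
   Context: Functions are complex-valued. The Fourier transform is $\widehat h(\xi)=\int_{\mathbb{R}^d}h(x)e^{-2\pi i\xi\cdot x}\,dx$ for $h\in L^1(\mathbb{R}^d)$, extended to a unitary map on $L^2(\mathbb{R}^d)$. A scattering filter bank on $\mathbb{R}^d$ is a pair $(\chi,\Psi)$, where $\Psi=(\psi_\lambda)_{\lambda\in\Lambda}$ is indexed by a countable set $\Lambda$, and $\chi,\psi_\lambda\in L^1(\mathbb{R}^d)\cap L^2(\mathbb{R}^d)$ for every $\lambda\in\Lambda$, such that $$|\widehat\chi(\xi)|^2+\sum_{\lambda\in\Lambda}|\widehat\psi_\lambda(\xi)|^2=1\quad\text{for almost every }\xi\in\mathbb{R}^d,$$ and such that $\widehat\chi(0)\neq0$. Paths: for $n\ge1$, $\Lambda^n$ is the set of $n$-tuples $p=(\lambda_1,\dots,\lambda_n)$ of elements of $\Lambda$; $\Lambda^0=\{e\}$ with $e$ the empty path; $\Lambda^\ast=\bigcup_{n\ge0}\Lambda^n$. For $f\in L^2(\mathbb{R}^d)$ set $U[e]f=f$, $U[\lambda]f=|f*\psi_\lambda|$ for $\lambda\in\Lambda$, and $U[p]f=U[\lambda_n]\cdots U[\lambda_1]f$ for $p=(\lambda_1,\dots,\lambda_n)$, $n\ge1$ (so $U[\lambda_1]$ is applied first). Set $\mathsf{S}_\chi[p]f=(U[p]f)*\chi$, $U_Nf=(U[p]f)_{p\in\Lambda^N}$ and $\mathsf{S}_\chi f=(\mathsf{S}_\chi[p]f)_{p\in\Lambda^\ast}$. For a family $(g_p)_{p\in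 P}$ of functions in $L^2(\mathbb{R}^d)$, $\|(g_p)_{p\in P}\|_{\ell^2(P;L^2(\mathbb{R}^d))}^2=\sum_{p\in P}\|g_p\|_2^2$. The filter bank $(\chi,\Psi)$ is called admissible if $\lim_{N\to\infty}\|U_Nf\|_{\ell^2(\Lambda^N;L^2(\mathbb{R}^d))}=0$ for every $f\in L^2(\mathbb{R}^d)$. "Norm-preserving" means $\|\mathsf{S}_\chi f\|_{\ell^2(\Lambda^\ast;L^2(\mathbb{R}^d))}=\|f\|_2$ for all $f\in L^2(\mathbb{R}^d)$ (the map $\mathsf{S}_\chi$ is nonlinear). *)

theory Defs
  imports "HOL-Analysis.Analysis"
begin

text \<open>
  \<open>\<real>\<^sup>d\<close> is an arbitrary type of class \<open>euclidean_space\<close> (so \<open>d \<ge> 1\<close>).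
  Elements of \<open>L\<^sup>1\<close> and \<open>L\<^sup>2\<close> are represented by Lebesgue measurable functions; every
  operation below gives (almost everywhere) equal results on almost everywhere equal functions.
  The low-pass filter \<open>chi\<close> is called \<open>\<phi>\<close> here, since the symbol for chi is reserved syntax.
  Norms take values in \<open>[0, \<infinity>]\<close>, so that a divergent sum or integral has the value \<open>\<infinity>\<close>.
\<close>

definition esqrt :: "ennreal \<Rightarrow> ennreal" where
  "esqrt x = (if x = \<infinity> then \<infinity> else ennreal (sqrt (enn2real x)))"

definition L1 :: "('a::euclidean_space \<Rightarrow> complex) set" where
  "L1 = {f. integrable lebesgue f}"

definition L2_norm :: "('a::euclidean_space \<Rightarrow> complex) \<Rightarrow> ennreal" where
  "L2_norm f = esqrt (\<integral>\<^sup>+ x. ennreal ((cmod (f x))\<^sup>2) \<partial>lebesgue)"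

definition L2 :: "('a::euclidean_space \<Rightarrow> complex) set" where
  "L2 = {f. f \<in> borel_measurable lebesgue \<and> L2_norm f < \<infinity>}"

definition ell2_norm :: "'p set \<Rightarrow> ('p \<Rightarrow> 'a::euclidean_space \<Rightarrow> complex) \<Rightarrow> ennreal" where
  "ell2_norm P g = esqrt (\<Sum>\<^sub>\<infinity>p\<in>P. (L2_norm (g p))\<^sup>2)"

definition ell2 :: "'p set \<Rightarrow> ('p \<Rightarrow> 'a::euclidean_space \<Rightarrow> complex) set" where
  "ell2 P = {g. (\<forall>p\<in>P. g p \<in> L2) \<and> ell2_norm P g < \<infinity>}"

definition fourier :: "('a::euclidean_space \<Rightarrow> complex) \<Rightarrow> 'a \<Rightarrow> complex" where
  "fourier h \<xi> = (LINT x|lebesgue. h x * exp (- 2 * of_real pi * \<i> * of_real (\<xi> \<bullet> x)))"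

text \<open>For \<open>f \<in> L\<^sup>2\<close> and \<open>g \<in> L\<^sup>1 \<inter> L\<^sup>2\<close> the integrand is integrable for every \<open>x\<close>.\<close>

definition conv :: "('a::euclidean_space \<Rightarrow> complex) \<Rightarrow> ('a \<Rightarrow> complex) \<Rightarrow> 'a \<Rightarrow> complex" where
  "conv f g x = (LINT y|lebesgue. f y * g (x - y))"

definition scattering_filter_bank ::
  "('a::euclidean_space \<Rightarrow> complex) \<Rightarrow> 'l set \<Rightarrow> ('l \<Rightarrow> 'a \<Rightarrow> complex) \<Rightarrow> bool" where
  "scattering_filter_bank \<phi> \<Lambda> \<psi> \<longleftrightarrow>
     countable \<Lambda> \<and> \<phi> \<in> L1 \<inter> L2 \<and> (\<forall>l\<in>\<Lambda>. \<psi> l \<in> L1 \<inter> L2) \<and>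
     (AE \<xi> in lebesgue.
        ennreal ((cmod (fourier \<phi> \<xi>))\<^sup>2) + (\<Sum>\<^sub>\<infinity>l\<in>\<Lambda>. ennreal ((cmod (fourier (\<psi> l) \<xi>))\<^sup>2)) = 1) \<and>
     fourier \<phi> 0 \<noteq> 0"

definition paths_of_length :: "'l set \<Rightarrow> nat \<Rightarrow> 'l list set" where
  "paths_of_length \<Lambda> n = {p. set p \<subseteq> \<Lambda> \<and> length p = n}"

definition all_paths :: "'l set \<Rightarrow> 'l list set" where
  "all_paths \<Lambda> = (\<Union>n. paths_of_length \<Lambda> n)"

definition scat_U1 ::
  "('l \<Rightarrow> 'a::euclidean_space \<Rightarrow> complex) \<Rightarrow> 'l \<Rightarrow> ('a \<Rightarrow> complex) \<Rightarrow> 'a \<Rightarrow> complex" where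
  "scat_U1 \<psi> l f = (\<lambda>x. complex_of_real (cmod (conv f (\<psi> l) x)))"

text \<open>The head of the list is the filter that is applied first.\<close>

primrec scat_U ::
  "('l \<Rightarrow> 'a::euclidean_space \<Rightarrow> complex) \<Rightarrow> 'l list \<Rightarrow> ('a \<Rightarrow> complex) \<Rightarrow> 'a \<Rightarrow> complex" where
  "scat_U \<psi> [] f = f"
| "scat_U \<psi> (l # p) f = scat_U \<psi> p (scat_U1 \<psi> l f)"

definition scat_S ::
  "('a::euclidean_space \<Rightarrow> complex) \<Rightarrow> ('l \<Rightarrow> 'a \<Rightarrow> complex) \<Rightarrow> 'l list \<Rightarrow> ('a \<Rightarrow> complex)
     \<Rightarrow> 'a \<Rightarrow> complex" where
  "scat_S \<phi> \<psi> p f = conv (scat_U \<psi> p f) \<phi>"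

text \<open>Admissibility of \<open>(\<phi>, \<Psi>)\<close> does not involve \<open>\<phi>\<close>.\<close>

definition admissible :: "'l set \<Rightarrow> ('l \<Rightarrow> 'a::euclidean_space \<Rightarrow> complex) \<Rightarrow> bool" where
  "admissible \<Lambda> \<psi> \<longleftrightarrow>
     (\<forall>f\<in>L2. (\<lambda>N. ell2_norm (paths_of_length \<Lambda> N) (\<lambda>p. scat_U \<psi> p f)) \<longlonglongrightarrow> 0)"

definition norm_preserving ::
  "('a::euclidean_space \<Rightarrow> complex) \<Rightarrow> 'l set \<Rightarrow> ('l \<Rightarrow> 'a \<Rightarrow> complex) \<Rightarrow> bool" where
  "norm_preserving \<phi> \<Lambda> \<psi> \<longleftrightarrow>
     (\<forall>f\<in>L2. ell2_norm (all_paths \<Lambda>) (\<lambda>p. scat_S \<phi> \<psi> p f) = L2_norm f)"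

end

theory Submission
  imports Defs "HOL-Probability.Characteristic_Functions"
begin

text \<open>Write the energy of a function for the square of its \<open>L\<^sup>2\<close> norm. One step of the cascade
  preserves energy: the energy of \<open>g\<close> is the energy of \<open>g * \<phi>\<close> plus the energies of the functions
  \<open>\<bar>g * \<psi> l\<bar>\<close> (lemma \<open>one_step_energy_eq\<close>). Hence the energy of the layers decreases, and what the
  low-pass outputs collect is exactly what the layers lose. Everything follows once the energy of
  the \<open>N\<close>-th layer is shown to tend to zero.

  Since the energies of the low-pass outputs have a finite sum, they tend to zero; and since the
  transform of \<open>\<phi>\<close> is continuous and does not vanish at the origin, no energy can stay in some
  fixed ball about the origin in frequency. To extend this to all frequencies, energy is measured
  with Gaussian weights. Let \<open>L s g\<close> be the integral of \<open>exp (- s \<bar>\<xi>\<bar>\<^sup>2)\<close> against the squared transform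
  of \<open>g\<close>. It equals the double integral of \<open>g(x) cnj(g(y)) k\<^sub>s(x - y)\<close> over \<open>x\<close> and \<open>y\<close>, where \<open>k\<^sub>s\<close> is a
  positive Gaussian of total mass 1, of width proportional to the square root of \<open>s\<close>.
  Positivity of the kernel makes the modulus push energy towards the origin. Quantitatively
  (lemma \<open>low_energy_modulus\<close>), as \<open>k\<^sub>t \<le> (s/t)\<^sup>d\<^sup>/\<^sup>2 k\<^sub>s\<close> for \<open>t \<le> s\<close>,

    \<open>L t g \<le> (s/t)\<^sup>d\<^sup>/\<^sup>2 L s \<bar>g\<bar>\<close>  for \<open>t \<le> s\<close>.

  This is used twice.

  With \<open>s = t\<close> it says that the complementary high-frequency energy, with weight
  \<open>1 - exp (- s \<bar>\<xi>\<bar>\<^sup>2)\<close>, does not increase under the modulus, and so not from layer to layer. At every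
  depth it is at most that of the input, which is small when \<open>s\<close> is small
  (lemmas \<open>high_energy_layers_le\<close> and \<open>high_energy_tendsto_0\<close>): energy does not escape to infinite
  frequency.

  With \<open>s\<close> much larger than \<open>t\<close> it bounds the energy of a layer below a frequency of order
  \<open>t\<^sup>-\<^sup>1\<^sup>/\<^sup>2\<close> by \<open>(s/t)\<^sup>d\<^sup>/\<^sup>2\<close> times the energy of the next layer very near the origin. The latter is
  at most a constant times the vanishing low-pass energy, plus the part of the Gaussian weight
  outside a ball of radius \<open>r\<close>, which is at most \<open>exp (- s r\<^sup>2)\<close>. The exponential beats the power of \<open>s\<close>,
  so this energy tends to zero with the depth for every \<open>t\<close> (lemma
  \<open>layer_energy_tendsto_0_bounded\<close>).

  The argument runs entirely inside the class of bounded integrable functions, which convolution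
  with an integrable filter and the modulus preserve, and where the Fourier transform is an
  ordinary integral. Plancherel's theorem for this class comes out of the same Gaussian identity
  as \<open>s\<close> tends to zero. General square integrable inputs are approximated by truncation, because
  the cascade is nonexpansive (lemma \<open>layer_nonexpansive\<close>).\<close>

section \<open>Affine substitutions and product integrals\<close>

text \<open>
  The linear part is a homothety only: translations, the reflection \<open>y \<mapsto> x - y\<close> and rescaling of
  a Gaussian are the substitutions that occur below.
\<close>

lemma nn_integral_lborel_affine:
  fixes c :: real and t :: "'a::euclidean_space"
  assumes [measurable]: "f \<in> borel_measurable borel" and c: "c \<noteq> 0"
  shows "(\<integral>\<^sup>+x. f x \<partial>lborel) = ennreal (\<bar>c\<bar> ^ DIM('a)) * (\<integral>\<^sup>+x. f (t + c *\<^sub>R x) \<partial>lborel)"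
  by (subst lborel_affine[OF c, of t])
    (simp add: nn_integral_density nn_integral_distr nn_integral_cmult)

lemma integrable_lborel_affine:
  fixes f :: "'a::euclidean_space \<Rightarrow> 'b::{banach, second_countable_topology}"
  assumes f: "integrable lborel f" and c: "c \<noteq> 0"
  shows "integrable lborel (\<lambda>x. f (t + c *\<^sub>R x))"
proof -
  have [measurable]: "f \<in> borel_measurable borel"
    using borel_measurable_integrable[OF f] by simp
  have "ennreal (\<bar>c\<bar> ^ DIM('a)) * (\<integral>\<^sup>+x. norm (f (t + c *\<^sub>R x)) \<partial>lborel) < \<infinity>"
    using f nn_integral_lborel_affine[of "\<lambda>x. ennreal (norm (f x))" c t] c
    unfolding integrable_iff_bounded by auto
  then show ?thesis
    using c by (auto simp: integrable_iff_bounded ennreal_mult_less_top)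
qed

lemma integral_lborel_affine:
  fixes f :: "'a::euclidean_space \<Rightarrow> 'b::{banach, second_countable_topology}" and c :: real
  assumes [measurable]: "f \<in> borel_measurable borel" and c: "c \<noteq> 0"
  shows "(\<integral>x. f x \<partial>lborel) = (\<bar>c\<bar> ^ DIM('a)) *\<^sub>R (\<integral>x. f (t + c *\<^sub>R x) \<partial>lborel)"
  by (subst lborel_affine[OF c, of t]) (simp add: integral_density integral_distr)

lemma
  fixes f :: "'a \<Rightarrow> 'c::{real_normed_field, banach, second_countable_topology}"
    and g :: "'b \<Rightarrow> 'c"
  assumes "sigma_finite_measure M" "sigma_finite_measure N"
    and f: "integrable M f" and g: "integrable N g"
  shows integrable_tensor: "integrable (M \<Otimes>\<^sub>M N) (\<lambda>(x, y). f x * g y)"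
    and integral_tensor: "integral\<^sup>L (M \<Otimes>\<^sub>M N) (\<lambda>(x, y). f x * g y) = integral\<^sup>L M f * integral\<^sup>L N g"
proof -
  interpret pair_sigma_finite M N
    using assms(1,2) by (simp add: pair_sigma_finite_def)
  have [measurable]: "f \<in> borel_measurable M" "g \<in> borel_measurable N"
    using f g by auto
  show i: "integrable (M \<Otimes>\<^sub>M N) (\<lambda>(x, y). f x * g y)"
    by (rule Fubini_integrable) (use f g in \<open>auto simp: norm_mult\<close>)
  show "integral\<^sup>L (M \<Otimes>\<^sub>M N) (\<lambda>(x, y). f x * g y) = integral\<^sup>L M f * integral\<^sup>L N g"
    by (subst integral_fst'[OF i, symmetric]) simp
qed

section \<open>Gaussians and their Fourier transforms\<close>

definition gaussian :: "real \<Rightarrow> 'a::euclidean_space \<Rightarrow> real" where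
  "gaussian s \<xi> = exp (- s * (norm \<xi>)\<^sup>2)"

definition character :: "'a::euclidean_space \<Rightarrow> 'a \<Rightarrow> complex" where
  "character \<xi> x = exp (- 2 * of_real pi * \<i> * of_real (\<xi> \<bullet> x))"

text \<open>
  This is the Fourier transform of \<open>gaussian s\<close>, see \<open>gaussian_fourier\<close> below.
\<close>

definition gauss_kernel :: "real \<Rightarrow> 'a::euclidean_space \<Rightarrow> real" where
  "gauss_kernel s z = sqrt (pi / s) ^ DIM('a) * gaussian (pi\<^sup>2 / s) z"

lemma character_measurable [measurable]:
  assumes [measurable]: "f \<in> borel_measurable M" "g \<in> borel_measurable M"
  shows "(\<lambda>x. character (f x) (g x)) \<in> borel_measurable M"
  unfolding character_def by measurable

lemma gaussian_measurable [measurable]: "gaussian s \<in> borel_measurable borel"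
  unfolding gaussian_def by measurable

lemma gauss_kernel_measurable [measurable]: "gauss_kernel s \<in> borel_measurable borel"
  unfolding gauss_kernel_def by measurable

lemma norm_character [simp]: "cmod (character \<xi> x) = 1"
  by (simp add: character_def norm_exp_eq_Re)

lemma character_add: "character \<xi> (x + y) = character \<xi> x * character \<xi> y"
  by (simp add: character_def inner_add_right algebra_simps exp_add[symmetric])

lemma cnj_character: "cnj (character \<xi> x) = character \<xi> (- x)"
  by (simp add: character_def exp_cnj)

lemma character_diff: "character \<xi> (x - y) = character \<xi> x * cnj (character \<xi> y)"
  using character_add[of \<xi> x "- y"] by (simp add: cnj_character)

lemma gaussian_pos: "gaussian s \<xi> > 0"
  by (simp add: gaussian_def)

lemma gaussian_le_1: "s \<ge> 0 \<Longrightarrow> gaussian s \<xi> \<le> 1"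
  by (simp add: gaussian_def)

lemma gauss_kernel_nonneg: "s > 0 \<Longrightarrow> gauss_kernel s z \<ge> 0"
  by (simp add: gauss_kernel_def less_imp_le[OF gaussian_pos])

text \<open>
  Rescaling of the characteristic function of the standard normal distribution.
\<close>

lemma gaussian_fourier_1d:
  fixes s z :: real
  assumes s: "s > 0"
  shows "integrable lborel (\<lambda>t. complex_of_real (exp (- s * t\<^sup>2)) * exp (- 2 * of_real pi * \<i> * of_real (t * z)))"
    and "(LINT t|lborel. complex_of_real (exp (- s * t\<^sup>2)) * exp (- 2 * of_real pi * \<i> * of_real (t * z)))
      = of_real (sqrt (pi / s) * exp (- pi\<^sup>2 / s * z\<^sup>2))"
proof -
  define c where "c = sqrt (2 * s)"
  have c: "c > 0" "c\<^sup>2 = 2 * s" using s by (auto simp: c_def)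
  \<comment> \<open>The substitution \<open>t \<mapsto> c t\<close> turns \<open>t\<^sup>2 / 2\<close> into \<open>s t\<^sup>2\<close>; \<open>u\<close> is chosen so that \<open>u c = - 2 \<pi> z\<close>.\<close>
  define u where "u = - 2 * pi * z / c"
  define F where "F x = std_normal_density x *\<^sub>R iexp (u * x)" for x
  have intF: "integrable lborel F"
    unfolding F_def
    by (rule Bochner_Integration.integrable_bound[of _ "std_normal_density"])
      (auto simp: normal_density_nonneg)
  have "char std_normal_distribution u = (LINT x|lborel. F x)"
    unfolding char_def F_def by (subst integral_density) (auto simp: normal_density_nonneg)
  then have F: "(LINT x|lborel. F x) = exp (- (u^2) / 2)"
    by (simp add: char_std_normal_distribution)
  have Fc: "F (0 + c * x) = of_real (1 / sqrt (2 * pi)) *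
      (complex_of_real (exp (- s * x\<^sup>2)) * exp (- 2 * of_real pi * \<i> * of_real (x * z)))" for x
  proof -
    have 1: "std_normal_density (c * x) = (1 / sqrt (2 * pi)) * exp (- s * x\<^sup>2)"
      by (simp add: normal_density_def power_mult_distrib c)
    have 2: "iexp (u * (c * x)) = exp (- 2 * of_real pi * \<i> * of_real (x * z))"
      using c by (simp add: u_def field_simps)
    show ?thesis unfolding F_def add_0 1 2 scaleR_conv_of_real by simp
  qed
  have "integrable lborel (\<lambda>x. of_real (1 / sqrt (2 * pi)) *
      (complex_of_real (exp (- s * x\<^sup>2)) * exp (- 2 * of_real pi * \<i> * of_real (x * z))))"
    using lborel_integrable_real_affine[OF intF, of c 0] c unfolding Fc by simp
  from integrable_mult_right[OF this, of "of_real (sqrt (2 * pi))"]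
  show "integrable lborel (\<lambda>t. complex_of_real (exp (- s * t\<^sup>2)) * exp (- 2 * of_real pi * \<i> * of_real (t * z)))"
    by (simp add: mult.assoc[symmetric] del: of_real_mult of_real_divide flip: of_real_mult)
  have "(LINT x|lborel. F x) = \<bar>c\<bar> *\<^sub>R (LINT x|lborel. F (0 + c * x))"
    using c by (intro lborel_integral_real_affine) auto
  also have "\<dots> = of_real (c / sqrt (2 * pi)) * (LINT t|lborel. complex_of_real (exp (- s * t\<^sup>2)) * exp (- 2 * of_real pi * \<i> * of_real (t * z)))"
    unfolding Fc integral_mult_right_zero scaleR_conv_of_real using c by simp
  finally have "(LINT t|lborel. complex_of_real (exp (- s * t\<^sup>2)) * exp (- 2 * of_real pi * \<i> * of_real (t * z)))
     = of_real (sqrt (2 * pi) / c * exp (- (u^2) / 2))"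
    unfolding F using c by (simp add: field_simps)
  also have "sqrt (2 * pi) / c = sqrt (pi / s)"
    using s by (simp add: c_def real_sqrt_mult real_sqrt_divide)
  also have "- (u^2) / 2 = - pi\<^sup>2 / s * z\<^sup>2"
    by (simp add: u_def power_divide power_mult_distrib c field_simps)
  finally show "(LINT t|lborel. complex_of_real (exp (- s * t\<^sup>2)) * exp (- 2 * of_real pi * \<i> * of_real (t * z)))
      = of_real (sqrt (pi / s) * exp (- pi\<^sup>2 / s * z\<^sup>2))" .
qed

lemma norm_sum_Basis_squared:
  fixes g :: "'a::euclidean_space \<Rightarrow> real"
  shows "(norm (\<Sum>b\<in>Basis. g b *\<^sub>R b))\<^sup>2 = (\<Sum>b\<in>(Basis::'a set). (g b)\<^sup>2)"
  unfolding power2_norm_eq_inner by (subst euclidean_inner) (simp add: power2_eq_square)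

text \<open>
  The integrand is a product of functions of the single coordinates, so the one-dimensional formula
  is applied in each of them.
\<close>

lemma
  fixes z :: "'a::euclidean_space"
  assumes s: "s > 0"
  shows integrable_gaussian_character: "integrable lborel (\<lambda>\<xi>::'a. of_real (gaussian s \<xi>) * character \<xi> z)" 
    and gaussian_fourier: "(LINT \<xi>|lborel. of_real (gaussian s \<xi>) * character \<xi> z) = of_real (gauss_kernel s z)"
proof -
  interpret product_sigma_finite "\<lambda>_::'a. lborel :: real measure" ..
  define f where "f b t = complex_of_real (exp (- s * t\<^sup>2)) * exp (- 2 * of_real pi * \<i> * of_real (t * (z \<bullet> b)))"
    for b :: 'a and t :: real
  have f: "integrable lborel (f b)" "integral\<^sup>L lborel (f b) = of_real (sqrt (pi / s) * exp (- pi\<^sup>2 / s * (z \<bullet> b)\<^sup>2))" for b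
    unfolding f_def by (rule gaussian_fourier_1d[OF s])+
  let ?T = "\<lambda>g. \<Sum>b\<in>(Basis::'a set). g b *\<^sub>R b"
  have eq: "of_real (gaussian s (?T g)) * character (?T g) z = (\<Prod>b\<in>Basis. f b (g b))" for g
  proof -
    have "?T g \<bullet> z = (\<Sum>b\<in>Basis. g b * (z \<bullet> b))"
      unfolding inner_sum_left by (simp add: inner_commute)
    then have "character (?T g) z = (\<Prod>b\<in>Basis. exp (- 2 * of_real pi * \<i> * of_real (g b * (z \<bullet> b))))"
      unfolding character_def by (simp add: exp_sum[symmetric] sum_distrib_left)
    moreover have "gaussian s (?T g) = (\<Prod>b\<in>(Basis::'a set). exp (- s * (g b)\<^sup>2))"
      unfolding gaussian_def norm_sum_Basis_squared by (simp add: exp_sum[symmetric] sum_distrib_left sum_negf)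
    ultimately show ?thesis
      by (simp add: f_def prod.distrib)
  qed
  have T[measurable]: "?T \<in> (\<Pi>\<^sub>M b\<in>(Basis::'a set). lborel) \<rightarrow>\<^sub>M borel"
    by measurable
  have i: "integrable (\<Pi>\<^sub>M b\<in>(Basis::'a set). lborel) (\<lambda>g. \<Prod>b\<in>Basis. f b (g b))"
    by (rule product_integrable_prod) (auto simp: f)
  have m: "(\<lambda>\<xi>::'a. of_real (gaussian s \<xi>) * character \<xi> z) \<in> borel_measurable borel" by measurable
  show "integrable lborel (\<lambda>\<xi>::'a. of_real (gaussian s \<xi>) * character \<xi> z)"
    by (subst lborel_def, subst lborel_eq_real[symmetric], subst integrable_distr_eq[OF T m]) (simp add: eq i)
  have "(LINT \<xi>|lborel. of_real (gaussian s \<xi>) * character \<xi> z)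
      = (LINT g|(\<Pi>\<^sub>M b\<in>(Basis::'a set). lborel). (\<Prod>b\<in>Basis. f b (g b)))"
    by (subst lborel_def, subst lborel_eq_real[symmetric], subst integral_distr[OF T m]) (simp add: eq)
  also have "\<dots> = (\<Prod>b\<in>(Basis::'a set). integral\<^sup>L lborel (f b))"
    by (rule product_integral_prod) (auto simp: f)
  also have "\<dots> = of_real (\<Prod>b\<in>(Basis::'a set). sqrt (pi / s) * exp (- pi\<^sup>2 / s * (z \<bullet> b)\<^sup>2))"
    by (simp add: f)
  also have "(\<Prod>b\<in>(Basis::'a set). sqrt (pi / s) * exp (- pi\<^sup>2 / s * (z \<bullet> b)\<^sup>2)) = gauss_kernel s z"
    unfolding gauss_kernel_def prod.distrib gaussian_def
    using norm_sum_Basis_squared[of "\<lambda>b. z \<bullet> b"]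
    by (simp add: exp_sum[symmetric] euclidean_representation sum_distrib_left sum_negf)
  finally show "(LINT \<xi>|lborel. of_real (gaussian s \<xi>) * character \<xi> z) = of_real (gauss_kernel s z)" .
qed

lemma
  assumes s: "s > 0"
  shows integrable_gaussian: "integrable lborel (gaussian s :: 'a::euclidean_space \<Rightarrow> real)"
    and integral_gaussian: "integral\<^sup>L lborel (gaussian s :: 'a \<Rightarrow> real) = sqrt (pi / s) ^ DIM('a)"
proof -
  have z: "character \<xi> (0::'a) = 1" for \<xi> by (simp add: character_def)
  show "integrable lborel (gaussian s :: 'a::euclidean_space \<Rightarrow> real)"
    using integrable_gaussian_character[OF s, of "0::'a"] by (simp add: z complex_of_real_integrable_eq)
  show "integral\<^sup>L lborel (gaussian s :: 'a \<Rightarrow> real) = sqrt (pi / s) ^ DIM('a)"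
    using gaussian_fourier[OF s, of "0::'a"] 
    by (simp add: z gauss_kernel_def gaussian_def[abs_def] del: of_real_power of_real_mult)
qed

lemma
  assumes s: "s > 0"
  shows integrable_gauss_kernel: "integrable lborel (gauss_kernel s :: 'a::euclidean_space \<Rightarrow> real)"
    and integral_gauss_kernel: "integral\<^sup>L lborel (gauss_kernel s :: 'a \<Rightarrow> real) = 1"
proof -
  have "pi\<^sup>2 / s > 0" using s by simp
  note g = integrable_gaussian[OF this, where 'a='a] integral_gaussian[OF this, where 'a='a]
  show "integrable lborel (gauss_kernel s :: 'a::euclidean_space \<Rightarrow> real)"
    unfolding gauss_kernel_def[abs_def] using g by simp
  show "integral\<^sup>L lborel (gauss_kernel s :: 'a \<Rightarrow> real) = 1"
    unfolding gauss_kernel_def[abs_def] using g s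
    by (simp flip: power_mult_distrib real_sqrt_mult add: power2_eq_square)
qed

text \<open>
  A narrow Gaussian is dominated by a multiple of a wide one. The factor is the ratio of the values
  at the origin; it is the price paid later for comparing a wide frequency band with a narrow one.
\<close>

lemma gauss_kernel_le:
  assumes "0 < s'" "s' \<le> s"
  shows "gauss_kernel s' (z::'a::euclidean_space) \<le> sqrt (s / s') ^ DIM('a) * gauss_kernel s z"
proof -
  have "gaussian (pi\<^sup>2 / s') z \<le> gaussian (pi\<^sup>2 / s) z"
    unfolding gaussian_def using assms by (auto intro!: mult_right_mono simp: frac_le)
  moreover have "sqrt (pi / s') ^ DIM('a) = sqrt (s / s') ^ DIM('a) * sqrt (pi / s) ^ DIM('a)"
    using assms by (simp flip: power_mult_distrib real_sqrt_mult)
  ultimately show ?thesis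
    unfolding gauss_kernel_def using assms by (simp add: mult_left_mono mult.assoc)
qed

section \<open>The Fourier transform of integrable functions\<close>

text \<open>
  Boundedness is required everywhere, not just almost everywhere, so that pointwise estimates need no
  exceptional sets. The class lies inside \<open>L\<^sup>2\<close> and is preserved by every step of the cascade.
\<close>

definition bounded_integrable :: "('a::euclidean_space \<Rightarrow> complex) \<Rightarrow> bool" where
  "bounded_integrable f \<longleftrightarrow> integrable lborel f \<and> (\<exists>C. \<forall>x. cmod (f x) \<le> C)"

lemma cnj_measurable [measurable (raw)]:
  "f \<in> borel_measurable M \<Longrightarrow> (\<lambda>x. cnj (f x)) \<in> borel_measurable M"
  by (rule measurable_compose[OF _ borel_measurable_continuous_onI[OF continuous_on_cnj[OF continuous_on_id]]])

lemma fourier_lborel: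
  assumes "h \<in> borel_measurable borel"
  shows "fourier h \<xi> = (LINT x|lborel. h x * character \<xi> x)"
proof -
  have "(\<lambda>x. h x * character \<xi> x) \<in> borel_measurable lborel" using assms by measurable
  then show ?thesis
    unfolding fourier_def character_def by (rule integral_completion)
qed

lemma fourier_measurable [measurable]:
  assumes [measurable]: "h \<in> borel_measurable borel"
  shows "fourier h \<in> borel_measurable borel"
proof -
  have "fourier h = (\<lambda>\<xi>. LINT x|lborel. h x * character \<xi> x)"
    by (rule ext) (rule fourier_lborel, measurable)
  then show ?thesis by simp
qed

lemma integrable_mult_character:
  assumes "integrable lborel h"
  shows "integrable lborel (\<lambda>x. h x * character \<xi> x)"
  by (rule Bochner_Integration.integrable_bound[OF assms])
    (use borel_measurable_integrable[OF assms] in \<open>auto simp: norm_mult\<close>)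

lemma norm_fourier_le:
  assumes "integrable lborel h"
  shows "cmod (fourier h \<xi>) \<le> (LINT x|lborel. cmod (h x))"
proof -
  have "cmod (fourier h \<xi>) \<le> (LINT x|lborel. cmod (h x * character \<xi> x))"
    using borel_measurable_integrable[OF assms] by (subst fourier_lborel) auto
  then show ?thesis by (simp add: norm_mult)
qed

lemma continuous_fourier:
  assumes h: "integrable lborel h"
  shows "isCont (fourier h) \<xi>"
proof -
  have [measurable]: "h \<in> borel_measurable borel" using borel_measurable_integrable[OF h] by simp
  have c: "isCont (\<lambda>\<xi>. character \<xi> x) \<xi>" for x \<xi> :: 'a
    unfolding character_def by (intro continuous_intros)
  have "((\<lambda>\<eta>. LINT x|lborel. h x * character \<eta> x) \<longlongrightarrow> (LINT x|lborel. h x * character \<xi> x)) (at \<xi>)"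
  proof (rule tendsto_at_iff_sequentially[THEN iffD2], intro allI impI)
    fix X :: "nat \<Rightarrow> 'a" assume X: "X \<longlonglongrightarrow> \<xi>"
    show "((\<lambda>\<eta>. LINT x|lborel. h x * character \<eta> x) \<circ> X) \<longlonglongrightarrow> (LINT x|lborel. h x * character \<xi> x)"
      unfolding o_def
    proof (rule integral_dominated_convergence[where w="\<lambda>x. cmod (h x)"])
      show "AE x in lborel. (\<lambda>i. h x * character (X i) x) \<longlonglongrightarrow> h x * character \<xi> x"
        using X c by (intro AE_I2 tendsto_mult tendsto_const) (auto intro: isCont_tendsto_compose)
    qed (use h in \<open>auto simp: norm_mult\<close>)
  qed
  moreover have "fourier h = (\<lambda>\<eta>. LINT x|lborel. h x * character \<eta> x)"
    by (rule ext) (rule fourier_lborel, measurable)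
  ultimately show ?thesis
    unfolding isCont_def by simp
qed

text \<open>
  The squared transform is the product of two integrals, hence one integral over pairs.
\<close>

lemma fourier_abs_squared:
  assumes h: "integrable lborel h"
  shows "complex_of_real ((cmod (fourier h \<xi>))\<^sup>2) =
    (LINT w|(lborel \<Otimes>\<^sub>M lborel). h (fst w) * cnj (h (snd w)) * character \<xi> (fst w - snd w))"
proof -
  have [measurable]: "h \<in> borel_measurable borel" using borel_measurable_integrable[OF h] by simp
  have "complex_of_real ((cmod (fourier h \<xi>))\<^sup>2) = fourier h \<xi> * cnj (fourier h \<xi>)"
    by (rule complex_norm_square)
  also have "\<dots> = (LINT x|lborel. h x * character \<xi> x) * (LINT x|lborel. cnj (h x * character \<xi> x))"
    by (subst Bochner_Integration.integral_cnj) (simp add: fourier_lborel)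
  also have "\<dots> = (LINT w|(lborel \<Otimes>\<^sub>M lborel). (case w of (x, y) \<Rightarrow> (h x * character \<xi> x) * cnj (h y * character \<xi> y)))"
    by (intro integral_tensor[symmetric] lborel.sigma_finite_measure_axioms
        integrable_mult_character[OF h] integrable_bounded_linear[OF bounded_linear_cnj])
  also have "\<dots> = (LINT w|(lborel \<Otimes>\<^sub>M lborel). h (fst w) * cnj (h (snd w)) * character \<xi> (fst w - snd w))"
    by (rule Bochner_Integration.integral_cong) (auto simp: character_diff)
  finally show ?thesis .
qed

section \<open>Gaussian-weighted spectral energy and the modulus\<close>

lemma integrable_autocorrelation:
  assumes "integrable lborel h"
  shows "integrable (lborel \<Otimes>\<^sub>M lborel) (\<lambda>w. h (fst w) * cnj (h (snd w)))"
proof -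
  have "integrable (lborel \<Otimes>\<^sub>M lborel) (\<lambda>(x, y). h x * cnj (h y))"
    by (rule integrable_tensor)
      (use assms in \<open>auto intro!: lborel.sigma_finite_measure_axioms\<close>)
  then show ?thesis by (simp add: split_beta')
qed

lemma integrable_gaussian_fourier:
  fixes h :: "'a::euclidean_space \<Rightarrow> complex"
  assumes h: "integrable lborel h" and s: "s > 0"
  shows "integrable lborel (\<lambda>\<xi>. gaussian s \<xi> * (cmod (fourier h \<xi>))\<^sup>2)"
proof -
  have [measurable]: "h \<in> borel_measurable borel" using borel_measurable_integrable[OF h] by simp
  define C where "C = (LINT x|lborel. cmod (h x))"
  show ?thesis
  proof (rule Bochner_Integration.integrable_bound)
    show "integrable lborel (\<lambda>\<xi>::'a. gaussian s \<xi> * C\<^sup>2)"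
      using integrable_gaussian[OF s] by auto
    show "AE \<xi> in lborel. norm (gaussian s \<xi> * (cmod (fourier h \<xi>))\<^sup>2) \<le> norm (gaussian s \<xi> * C\<^sup>2)"
      using norm_fourier_le[OF h] less_imp_le[OF gaussian_pos]
      by (auto simp: abs_mult C_def intro!: mult_left_mono power_mono)
  qed measurable
qed

lemma integrable_gauss_autocorrelation:
  fixes h :: "'a::euclidean_space \<Rightarrow> complex"
  assumes h: "integrable lborel h" and s: "s > 0"
  shows "integrable (lborel \<Otimes>\<^sub>M lborel)
    (\<lambda>w. h (fst w) * cnj (h (snd w)) * of_real (gauss_kernel s (fst w - snd w)))"
proof -
  have [measurable]: "h \<in> borel_measurable borel" using borel_measurable_integrable[OF h] by simp
  define C where "C = sqrt (pi / s) ^ DIM('a)"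
  have C: "C \<ge> 0" using s by (simp add: C_def)
  have "integrable (lborel \<Otimes>\<^sub>M lborel) (\<lambda>w. h (fst w) * cnj (h (snd w)) * of_real C)"
    using integrable_autocorrelation[OF h] by simp
  then show ?thesis
  proof (rule Bochner_Integration.integrable_bound)
    have "gauss_kernel s z \<le> C" for z :: 'a
      unfolding gauss_kernel_def C_def[symmetric] using C gaussian_le_1[of "pi\<^sup>2 / s" z] s
      by (simp add: mult_left_le)
    then have "\<bar>gauss_kernel s z\<bar> \<le> C" for z :: 'a
      by (simp add: abs_of_nonneg[OF gauss_kernel_nonneg[OF s]])
    then show "AE w in lborel \<Otimes>\<^sub>M lborel. norm (h (fst w) * cnj (h (snd w)) * of_real (gauss_kernel s (fst w - snd w)))
        \<le> norm (h (fst w) * cnj (h (snd w)) * of_real C)"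
      using C by (intro AE_I2) (auto simp: norm_mult intro!: mult_left_mono)
  qed measurable
qed

text \<open>
  Fubini, with the integral over \<open>\<xi>\<close> carried out by \<open>gaussian_fourier\<close>. This is the Plancherel
  identity tested against a Gaussian; it holds for every integrable function, and its right-hand side
  no longer mentions the transform.
\<close>

lemma gaussian_energy_eq:
  fixes h :: "'a::euclidean_space \<Rightarrow> complex"
  assumes h: "integrable lborel h" and s: "s > 0"
  shows "complex_of_real (LINT \<xi>|lborel. gaussian s \<xi> * (cmod (fourier h \<xi>))\<^sup>2) =
    (LINT w|(lborel \<Otimes>\<^sub>M lborel). h (fst w) * cnj (h (snd w)) * of_real (gauss_kernel s (fst w - snd w)))"
proof -
  have [measurable]: "h \<in> borel_measurable borel" using borel_measurable_integrable[OF h] by simp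
  let ?P = "lborel \<Otimes>\<^sub>M lborel :: ('a \<times> 'a) measure"
  interpret P: pair_sigma_finite ?P "lborel :: 'a measure"
    by (simp add: pair_sigma_finite_def lborel.sigma_finite_measure_axioms lborel_pair.sigma_finite_measure_axioms)
  define F where "F w \<xi> = h (fst w) * cnj (h (snd w)) * (of_real (gaussian s \<xi>) * character \<xi> (fst w - snd w))"
    for w \<xi>
  have [measurable]: "(\<lambda>(w, \<xi>). F w \<xi>) \<in> borel_measurable (?P \<Otimes>\<^sub>M lborel)"
    unfolding F_def by measurable
  have "integrable (?P \<Otimes>\<^sub>M lborel) (\<lambda>(w, \<xi>). (h (fst w) * cnj (h (snd w))) * complex_of_real (gaussian s \<xi>))"
    by (rule integrable_tensor)
      (use integrable_autocorrelation[OF h] integrable_gaussian[OF s] in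
        \<open>auto intro!: lborel.sigma_finite_measure_axioms lborel_pair.sigma_finite_measure_axioms\<close>)
  then have intF: "integrable (?P \<Otimes>\<^sub>M lborel) (\<lambda>(w, \<xi>). F w \<xi>)"
    by (rule Bochner_Integration.integrable_bound) (auto simp: F_def norm_mult)
  have "complex_of_real (LINT \<xi>|lborel. gaussian s \<xi> * (cmod (fourier h \<xi>))\<^sup>2)
      = (LINT \<xi>|lborel. of_real (gaussian s \<xi>) * complex_of_real ((cmod (fourier h \<xi>))\<^sup>2))"
    by (simp flip: integral_complex_of_real)
  also have "\<dots> = (LINT \<xi>|lborel. LINT w|?P. F w \<xi>)"
    unfolding fourier_abs_squared[OF h] F_def by (simp add: mult.left_commute flip: integral_mult_right_zero)
  also have "\<dots> = (LINT w|?P. LINT \<xi>|lborel. F w \<xi>)"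
    by (rule P.Fubini_integral[OF intF])
  also have "\<dots> = (LINT w|?P. h (fst w) * cnj (h (snd w)) * of_real (gauss_kernel s (fst w - snd w)))"
    unfolding F_def integral_mult_right_zero gaussian_fourier[OF s] by simp
  finally show ?thesis .
qed

text \<open>
  On the spatial side of \<open>gaussian_energy_eq\<close> the kernel is positive, so the triangle inequality
  replaces \<open>h\<close> by its modulus, and \<open>gauss_kernel_le\<close> trades \<open>s'\<close> for \<open>s\<close>. On the frequency side the
  result says that whatever \<open>h\<close> has in a wide band, its modulus has, up to a constant, close to
  the origin.
\<close>

lemma gaussian_energy_modulus:
  fixes h :: "'a::euclidean_space \<Rightarrow> complex"
  assumes h: "integrable lborel h" and s: "0 < s'" "s' \<le> s"
  shows "(LINT \<xi>|lborel. gaussian s' \<xi> * (cmod (fourier h \<xi>))\<^sup>2)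
    \<le> sqrt (s / s') ^ DIM('a) *
       (LINT \<xi>|lborel. gaussian s \<xi> * (cmod (fourier (\<lambda>x. complex_of_real (cmod (h x))) \<xi>))\<^sup>2)"
proof -
  let ?P = "lborel \<Otimes>\<^sub>M lborel :: ('a \<times> 'a) measure"
  let ?a = "\<lambda>x. complex_of_real (cmod (h x))"
  have a: "integrable lborel ?a" using h by simp
  have s0: "s > 0" using s by simp
  have "integrable ?P (\<lambda>w. complex_of_real (cmod (h (fst w)) * cmod (h (snd w)) * gauss_kernel s (fst w - snd w)))"
    using integrable_gauss_autocorrelation[OF a s0] by simp
  then have ia: "integrable ?P (\<lambda>w. cmod (h (fst w)) * cmod (h (snd w)) * gauss_kernel s (fst w - snd w))"
    unfolding complex_of_real_integrable_eq .
  have "complex_of_real (LINT \<xi>|lborel. gaussian s \<xi> * (cmod (fourier ?a \<xi>))\<^sup>2)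
      = (LINT w|?P. complex_of_real (cmod (h (fst w)) * cmod (h (snd w)) * gauss_kernel s (fst w - snd w)))"
    by (subst gaussian_energy_eq[OF a s0]) simp
  then have ea: "(LINT \<xi>|lborel. gaussian s \<xi> * (cmod (fourier ?a \<xi>))\<^sup>2)
      = (LINT w|?P. cmod (h (fst w)) * cmod (h (snd w)) * gauss_kernel s (fst w - snd w))"
    unfolding integral_complex_of_real of_real_eq_iff .
  have "(LINT \<xi>|lborel. gaussian s' \<xi> * (cmod (fourier h \<xi>))\<^sup>2)
      \<le> cmod (LINT w|?P. h (fst w) * cnj (h (snd w)) * of_real (gauss_kernel s' (fst w - snd w)))"
    by (subst gaussian_energy_eq[OF h s(1), symmetric]) (simp del: of_real_mult)
  also have "\<dots> \<le> (LINT w|?P. cmod (h (fst w) * cnj (h (snd w)) * of_real (gauss_kernel s' (fst w - snd w))))"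
    by (rule integral_norm_bound)
  also have "\<dots> \<le> (LINT w|?P. sqrt (s / s') ^ DIM('a) * (cmod (h (fst w)) * cmod (h (snd w)) * gauss_kernel s (fst w - snd w)))"
  proof (rule integral_mono)
    show "integrable ?P (\<lambda>w. cmod (h (fst w) * cnj (h (snd w)) * of_real (gauss_kernel s' (fst w - snd w))))"
      using integrable_gauss_autocorrelation[OF h s(1)] by (rule integrable_norm)
    show "integrable ?P (\<lambda>w. sqrt (s / s') ^ DIM('a) * (cmod (h (fst w)) * cmod (h (snd w)) * gauss_kernel s (fst w - snd w)))"
      using ia by simp
    fix w :: "'a \<times> 'a"
    have "cmod (h (fst w) * cnj (h (snd w)) * of_real (gauss_kernel s' (fst w - snd w)))
      = (cmod (h (fst w)) * cmod (h (snd w))) * gauss_kernel s' (fst w - snd w)"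
      by (simp add: norm_mult abs_of_nonneg[OF gauss_kernel_nonneg[OF s(1)]])
    also have "\<dots> \<le> (cmod (h (fst w)) * cmod (h (snd w))) * (sqrt (s / s') ^ DIM('a) * gauss_kernel s (fst w - snd w))"
      by (intro mult_left_mono gauss_kernel_le s) auto
    finally show "cmod (h (fst w) * cnj (h (snd w)) * of_real (gauss_kernel s' (fst w - snd w)))
      \<le> sqrt (s / s') ^ DIM('a) * (cmod (h (fst w)) * cmod (h (snd w)) * gauss_kernel s (fst w - snd w))"
      by (simp add: ac_simps)
  qed
  also have "\<dots> = sqrt (s / s') ^ DIM('a) * (LINT \<xi>|lborel. gaussian s \<xi> * (cmod (fourier ?a \<xi>))\<^sup>2)"
    unfolding ea by simp
  finally show ?thesis .
qed

section \<open>Continuity of translations in the mean\<close>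

text \<open>
  Continuity at the origin of the map that sends \<open>z\<close> to the translate of \<open>h\<close> by \<open>z\<close>, in the \<open>L\<^sup>1\<close> norm.
\<close>

definition translation_continuous :: "('a::euclidean_space \<Rightarrow> 'b::{banach, second_countable_topology}) \<Rightarrow> bool" where
  "translation_continuous h \<longleftrightarrow>
     (\<forall>Z. Z \<longlonglongrightarrow> 0 \<longrightarrow> (\<lambda>n. LINT x|lborel. norm (h (x + Z n) - h x)) \<longlonglongrightarrow> 0)"

lemma integrable_translate:
  fixes h :: "'a::euclidean_space \<Rightarrow> 'b::{banach, second_countable_topology}"
  assumes "integrable lborel h"
  shows "integrable lborel (\<lambda>x. h (x + z))"
  using integrable_lborel_affine[OF assms, of 1 z] by (simp add: add.commute)

lemma integral_translate:
  fixes h :: "'a::euclidean_space \<Rightarrow> 'b::{banach, second_countable_topology}"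
  assumes "h \<in> borel_measurable borel"
  shows "(LINT x|lborel. h (x + z)) = integral\<^sup>L lborel h"
  using integral_lborel_affine[OF assms, of 1 z] by (simp add: add.commute)

text \<open>
  Translation is an isometry of \<open>L\<^sup>1\<close>, so the property passes to limits.
\<close>

lemma translation_continuous_approx:
  fixes h :: "'a::euclidean_space \<Rightarrow> 'b::{banach, second_countable_topology}"
  assumes h: "integrable lborel h"
    and approx: "\<And>e. e > 0 \<Longrightarrow>
      \<exists>g. integrable lborel g \<and> translation_continuous g \<and> (LINT x|lborel. norm (h x - g x)) < e"
  shows "translation_continuous h"
  unfolding translation_continuous_def
proof (intro allI impI)
  fix Z :: "nat \<Rightarrow> 'a" assume Z: "Z \<longlonglongrightarrow> 0"
  show "(\<lambda>n. LINT x|lborel. norm (h (x + Z n) - h x)) \<longlonglongrightarrow> 0"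
  proof (rule LIMSEQ_I)
    fix r :: real assume r: "r > 0"
    obtain g where g: "integrable lborel g" "translation_continuous g" "(LINT x|lborel. norm (h x - g x)) < r / 3"
      using approx[of "r / 3"] r by auto
    have "(\<lambda>n. LINT x|lborel. norm (g (x + Z n) - g x)) \<longlonglongrightarrow> 0"
      using g(2) Z unfolding translation_continuous_def by blast
    then have "\<forall>\<^sub>F n in sequentially. (LINT x|lborel. norm (g (x + Z n) - g x)) < r / 3"
      using r by (intro order_tendstoD(2)) auto
    then obtain N where N: "\<And>n. n \<ge> N \<Longrightarrow> (LINT x|lborel. norm (g (x + Z n) - g x)) < r / 3"
      unfolding eventually_sequentially by blast
    have "norm ((LINT x|lborel. norm (h (x + Z n) - h x)) - 0) < r" if "n \<ge> N" for n
    proof -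
      have d: "integrable lborel (\<lambda>x. norm (h x - g x))" using h g by simp
      have m: "(\<lambda>x. norm (h x - g x)) \<in> borel_measurable borel"
        using borel_measurable_integrable[OF d] by simp
      have "(LINT x|lborel. norm (h (x + Z n) - h x))
        \<le> (LINT x|lborel. norm (h (x + Z n) - g (x + Z n)) + (norm (g (x + Z n) - g x) + norm (h x - g x)))"
      proof (rule integral_mono)
        show "norm (h (x + Z n) - h x) \<le> norm (h (x + Z n) - g (x + Z n)) + (norm (g (x + Z n) - g x) + norm (h x - g x))" for x
          using norm_triangle_ineq[of "h (x + Z n) - g (x + Z n)" "(g (x + Z n) - g x) - (h x - g x)"]
            norm_triangle_ineq4[of "g (x + Z n) - g x" "h x - g x"] by (simp add: algebra_simps)
        show "integrable lborel (\<lambda>x. norm (h (x + Z n) - g (x + Z n)) + (norm (g (x + Z n) - g x) + norm (h x - g x)))"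
          using integrable_translate[OF d, of "Z n"] integrable_translate[OF g(1), of "Z n"] g(1) d by simp
      qed (use h in \<open>auto intro!: integrable_translate\<close>)
      also have "\<dots> = (LINT x|lborel. norm (h (x + Z n) - g (x + Z n))) + ((LINT x|lborel. norm (g (x + Z n) - g x)) + (LINT x|lborel. norm (h x - g x)))"
        using integrable_translate[OF d, of "Z n"] integrable_translate[OF g(1), of "Z n"] g(1) d by simp
      also have "(LINT x|lborel. norm (h (x + Z n) - g (x + Z n))) = (LINT x|lborel. norm (h x - g x))"
        by (rule integral_translate[OF m])
      finally show ?thesis
        using g(3) N[OF that] by simp
    qed
    then show "\<exists>no. \<forall>n\<ge>no. norm ((LINT x|lborel. norm (h (x + Z n) - h x)) - 0) < r" by blast
  qed
qed

text \<open>
  The \<open>L\<^sup>1\<close> distance of the indicators of \<open>U\<close> and of a translate of \<open>U\<close> is expressed by the measure of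
  their intersection. That measure converges by dominated convergence, because for an open set a
  point of \<open>U\<close> is eventually in the translates of \<open>U\<close> as well.
\<close>

lemma translation_continuous_open:
  fixes U :: "'a::euclidean_space set" and c :: "'b::{banach, second_countable_topology}"
  assumes U: "open U" "emeasure lborel U < \<infinity>"
  shows "translation_continuous (\<lambda>x. indicator U x *\<^sub>R c)"
  unfolding translation_continuous_def
proof (intro allI impI)
  fix Z :: "nat \<Rightarrow> 'a" assume Z: "Z \<longlonglongrightarrow> 0"
  let ?u = "indicator U :: 'a \<Rightarrow> real"
  have [measurable]: "U \<in> sets borel" using U by simp
  have u: "integrable lborel ?u" using U by (intro integrable_real_indicator) auto
  have uz: "integrable lborel (\<lambda>x. ?u (x + z))" for z by (rule integrable_translate[OF u])
  have uu: "integrable lborel (\<lambda>x. ?u x * ?u (x + z))" for z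
    by (rule Bochner_Integration.integrable_bound[OF u]) (auto simp: indicator_def)
  have eq: "(LINT x|lborel. norm (?u (x + z) *\<^sub>R c - ?u x *\<^sub>R c))
      = norm c * (2 * integral\<^sup>L lborel ?u - 2 * (LINT x|lborel. ?u x * ?u (x + z)))" for z
  proof -
    have "(LINT x|lborel. norm (?u (x + z) *\<^sub>R c - ?u x *\<^sub>R c))
      = (LINT x|lborel. norm c * ((?u (x + z) + ?u x) - 2 * (?u x * ?u (x + z))))"
      by (rule Bochner_Integration.integral_cong) (auto simp: indicator_def)
    also have "\<dots> = norm c * ((LINT x|lborel. ?u (x + z)) + integral\<^sup>L lborel ?u - 2 * (LINT x|lborel. ?u x * ?u (x + z)))"
      using u uz[of z] uu[of z] by simp
    also have "(LINT x|lborel. ?u (x + z)) = integral\<^sup>L lborel ?u"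
      by (rule integral_translate) measurable
    finally show ?thesis by simp
  qed
  have "(\<lambda>n. LINT x|lborel. ?u x * ?u (x + Z n)) \<longlonglongrightarrow> integral\<^sup>L lborel ?u"
  proof (rule integral_dominated_convergence[where w="?u"])
    show "AE x in lborel. (\<lambda>n. ?u x * ?u (x + Z n)) \<longlonglongrightarrow> ?u x"
    proof (rule AE_I2)
      fix x
      show "(\<lambda>n. ?u x * ?u (x + Z n)) \<longlonglongrightarrow> ?u x"
      proof (cases "x \<in> U")
        case True
        have "(\<lambda>n. x + Z n) \<longlonglongrightarrow> x" using tendsto_add[OF tendsto_const Z, of x] by simp
        then have "\<forall>\<^sub>F n in sequentially. x + Z n \<in> U"
          by (rule topological_tendstoD[OF _ U(1) True])
        then have "\<forall>\<^sub>F n in sequentially. ?u x * ?u (x + Z n) = ?u x"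
          by eventually_elim (simp add: True)
        then show ?thesis by (rule tendsto_eventually)
      qed simp
    qed
  qed (use u in \<open>auto simp: indicator_def\<close>)
  then have "(\<lambda>n. norm c * (2 * integral\<^sup>L lborel ?u - 2 * (LINT x|lborel. ?u x * ?u (x + Z n))))
      \<longlonglongrightarrow> norm c * (2 * integral\<^sup>L lborel ?u - 2 * integral\<^sup>L lborel ?u)"
    by (intro tendsto_mult tendsto_diff tendsto_const)
  then show "(\<lambda>n. LINT x|lborel. norm (?u (x + Z n) *\<^sub>R c - ?u x *\<^sub>R c)) \<longlonglongrightarrow> 0"
    unfolding eq by simp
qed

text \<open>
  Open sets of finite measure approximate measurable sets by outer regularity; simple functions
  approximate the rest.
\<close>

theorem L1_translation_continuous:
  fixes h :: "'a::euclidean_space \<Rightarrow> 'b::{banach, second_countable_topology}"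
  assumes "integrable lborel h"
  shows "translation_continuous h"
  using assms
proof induction
  case (base A c)
  have [measurable]: "A \<in> sets borel" using base(1) by simp
  have iA: "integrable lborel (\<lambda>x. indicator A x *\<^sub>R c)"
    using base by (intro integrable_scaleR_left integrable_real_indicator)
  then show ?case
  proof (rule translation_continuous_approx)
    fix e :: real assume e: "e > 0"
    define d where "d = e / (norm c + 1)"
    have p: "norm c + 1 > 0" using norm_ge_zero[of c] by linarith
    have "norm c * e < e * (norm c + 1)" using e by (simp add: algebra_simps)
    then have d: "d > 0" "norm c * d < e"
      unfolding d_def times_divide_eq_right using pos_divide_less_eq[OF p] divide_pos_pos[OF e p] by blast+
    obtain U where U: "open U" "A \<subseteq> U" "emeasure lborel (U - A) < d"
      using outer_regular_lborel[of A d] d by auto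
    have [measurable]: "U \<in> sets borel" using U by simp
    have "emeasure lborel U \<le> emeasure lborel A + emeasure lborel (U - A)"
      using U(2) by (intro order_trans[OF emeasure_mono emeasure_subadditive]) auto
    also have "\<dots> < \<infinity>" using base(2) U(3) by (auto simp: less_top[symmetric])
    finally have fU: "emeasure lborel U < \<infinity>" .
    have fd: "emeasure lborel (U - A) < \<infinity>"
      using U(3) by (auto simp: less_top[symmetric])
    have "(LINT x|lborel. norm (indicator A x *\<^sub>R c - indicator U x *\<^sub>R c)) = (LINT x|lborel. norm c * indicator (U - A) x)"
      using U(2) by (intro Bochner_Integration.integral_cong) (auto simp: indicator_def)
    also have "\<dots> = norm c * measure lborel (U - A)" by simp
    also have "\<dots> \<le> norm c * d"
      using U(3) fd d by (intro mult_left_mono) (auto simp: emeasure_eq_ennreal_measure less_top ennreal_less_iff)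
    also have "\<dots> < e" by fact
    finally show "\<exists>g. integrable lborel g \<and> translation_continuous g \<and>
        (LINT x|lborel. norm (indicator A x *\<^sub>R c - g x)) < e"
      using translation_continuous_open[OF U(1) fU, of c] fU
      by (intro exI[of _ "\<lambda>x. indicator U x *\<^sub>R c"]) (auto intro!: integrable_scaleR_left integrable_real_indicator)
  qed
next
  case (add f g)
  show ?case
    unfolding translation_continuous_def
  proof (intro allI impI)
    fix Z :: "nat \<Rightarrow> 'a" assume Z: "Z \<longlonglongrightarrow> 0"
    have fz: "integrable lborel (\<lambda>x. f (x + Z n))" "integrable lborel (\<lambda>x. g (x + Z n))" for n
      using add.hyps by (auto intro: integrable_translate)
    have lim: "(\<lambda>n. (LINT x|lborel. norm (f (x + Z n) - f x)) + (LINT x|lborel. norm (g (x + Z n) - g x))) \<longlonglongrightarrow> 0"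
      using add.IH Z unfolding translation_continuous_def by (intro tendsto_add_zero) auto
    show "(\<lambda>n. LINT x|lborel. norm (f (x + Z n) + g (x + Z n) - (f x + g x))) \<longlonglongrightarrow> 0"
    proof (rule tendsto_sandwich[OF _ _ tendsto_const lim])
      show "\<forall>\<^sub>F n in sequentially. (LINT x|lborel. norm (f (x + Z n) + g (x + Z n) - (f x + g x)))
          \<le> (LINT x|lborel. norm (f (x + Z n) - f x)) + (LINT x|lborel. norm (g (x + Z n) - g x))"
      proof (rule always_eventually, rule allI)
        fix n
        have "(LINT x|lborel. norm (f (x + Z n) + g (x + Z n) - (f x + g x)))
          \<le> (LINT x|lborel. norm (f (x + Z n) - f x) + norm (g (x + Z n) - g x))"
          using add.hyps fz by (intro integral_mono norm_diff_triangle_ineq) auto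
        then show "(LINT x|lborel. norm (f (x + Z n) + g (x + Z n) - (f x + g x)))
          \<le> (LINT x|lborel. norm (f (x + Z n) - f x)) + (LINT x|lborel. norm (g (x + Z n) - g x))"
          using add.hyps fz[of n] by simp
      qed
    qed (auto intro!: always_eventually)
  qed
next
  case (lim f s)
  show ?case
  proof (rule translation_continuous_approx[OF lim.hyps(4)])
    fix e :: real assume e: "e > 0"
    have "(\<lambda>i. LINT x|lborel. norm (f x - s i x)) \<longlonglongrightarrow> (LINT x|(lborel :: 'a measure). 0)"
    proof (rule integral_dominated_convergence[where w="\<lambda>x. 3 * norm (f x)"])
      show "AE x in lborel. (\<lambda>i. norm (f x - s i x)) \<longlonglongrightarrow> 0"
      proof (rule AE_I2)
        fix x
        have "(\<lambda>i. f x - s i x) \<longlonglongrightarrow> f x - f x"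
          using lim.hyps(2) by (intro tendsto_diff tendsto_const) auto
        then show "(\<lambda>i. norm (f x - s i x)) \<longlonglongrightarrow> 0" by (simp add: tendsto_norm_zero)
      qed
      show "AE x in lborel. norm (norm (f x - s i x)) \<le> 3 * norm (f x)" for i
      proof (rule AE_I2)
        fix x
        show "norm (norm (f x - s i x)) \<le> 3 * norm (f x)"
          using lim.hyps(3)[of x i] norm_triangle_ineq4[of "f x" "s i x"] by simp
      qed
    qed (use lim.hyps in auto)
    then have "\<forall>\<^sub>F i in sequentially. (LINT x|lborel. norm (f x - s i x)) < e"
      using e by (intro order_tendstoD) auto
    then obtain i where "(LINT x|lborel. norm (f x - s i x)) < e"
      by (auto dest: eventually_happens)
    then show "\<exists>g. integrable lborel g \<and> translation_continuous g \<and> (LINT x|lborel. norm (f x - g x)) < e"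
      using lim.hyps(1) lim.IH by blast
  qed
qed

lemma L1_translation_error_le:
  fixes h :: "'a::euclidean_space \<Rightarrow> 'b::{banach, second_countable_topology}"
  assumes h: "integrable lborel h"
  shows "(LINT y|lborel. norm (h (y + z) - h y)) \<le> 2 * (LINT y|lborel. norm (h y))"
proof -
  have "(LINT y|lborel. norm (h (y + z) - h y)) \<le> (LINT y|lborel. norm (h (y + z)) + norm (h y))"
    using h integrable_translate[OF h] by (intro integral_mono norm_triangle_ineq4) auto
  also have "\<dots> = (LINT y|lborel. norm (h (y + z))) + (LINT y|lborel. norm (h y))"
    using h integrable_translate[OF h] by simp
  also have "(LINT y|lborel. norm (h (y + z))) = (LINT y|lborel. norm (h y))"
    using h by (intro integral_translate) auto
  finally show ?thesis by simp
qed

lemma gauss_kernel_scale: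
  assumes "c > 0"
  shows "c ^ DIM('a) * gauss_kernel (c\<^sup>2) (c *\<^sub>R u) = gauss_kernel 1 (u :: 'a::euclidean_space)"
proof -
  have "c * sqrt (pi / c\<^sup>2) = sqrt pi"
    using assms by (simp add: real_sqrt_divide)
  moreover have "gaussian (pi\<^sup>2 / c\<^sup>2) (c *\<^sub>R u) = gaussian (pi\<^sup>2) u"
    using assms by (simp add: gaussian_def power_mult_distrib)
  ultimately show ?thesis
    unfolding gauss_kernel_def by (simp flip: power_mult_distrib mult.assoc)
qed

section \<open>Plancherel's theorem for bounded integrable functions\<close>

text \<open>
  The parameter of the Gaussian is written as \<open>c\<^sup>2\<close>, so that the substitution \<open>x = y + c u\<close> turns its
  kernel into the fixed kernel \<open>gauss_kernel 1\<close>. Since that kernel has mass 1, the difference to the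
  energy of \<open>h\<close> is an average of \<open>L\<^sup>1\<close> distances between \<open>h\<close> and its translates by \<open>c u\<close>; one factor \<open>h\<close>
  is estimated by its bound.
\<close>

lemma gaussian_energy_error:
  fixes h :: "'a::euclidean_space \<Rightarrow> complex"
  assumes h: "integrable lborel h" and C: "\<And>x. cmod (h x) \<le> C" and c: "c > 0"
  shows "\<bar>(LINT \<xi>|lborel. gaussian (c\<^sup>2) \<xi> * (cmod (fourier h \<xi>))\<^sup>2) - (LINT x|lborel. (cmod (h x))\<^sup>2)\<bar>
    \<le> C * (LINT u|lborel. gauss_kernel 1 u * (LINT y|lborel. cmod (h (y + c *\<^sub>R u) - h y)))"
proof -
  have [measurable]: "h \<in> borel_measurable borel" using borel_measurable_integrable[OF h] by simp
  have C0: "C \<ge> 0" using C[of 0] norm_ge_zero[of "h 0"] by linarith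
  have c2: "c\<^sup>2 > 0" using c by simp
  define K :: "'a \<Rightarrow> real" where "K = gauss_kernel 1"
  have K0: "K u \<ge> 0" for u by (simp add: K_def gauss_kernel_nonneg)
  have [measurable]: "K \<in> borel_measurable borel" by (simp add: K_def gauss_kernel_measurable)
  have iK: "integrable lborel K" "integral\<^sup>L lborel K = 1"
    by (simp_all add: K_def integrable_gauss_kernel integral_gauss_kernel)
  \<comment> \<open>The integral of \<open>D y\<close> is the error at \<open>y\<close> of replacing \<open>h\<close> by its Gaussian average.\<close>
  define D where "D y u = (h (y + c *\<^sub>R u) - h y) * of_real (K u)" for y u
  have bK: "integrable lborel (\<lambda>u. g u * complex_of_real (K u))"
    if [measurable]: "g \<in> borel_measurable borel" and "\<And>u. cmod (g u) \<le> C" for g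
    by (rule Bochner_Integration.integrable_bound[of _ "\<lambda>u. C * K u"])
      (use iK that C0 K0 in \<open>auto simp: norm_mult intro!: mult_mono\<close>)
  have hK: "integrable lborel (\<lambda>u. h (y + c *\<^sub>R u) * complex_of_real (K u))" for y
    by (rule bK) (use C in auto)
  have D_int: "integrable (lborel \<Otimes>\<^sub>M lborel) (\<lambda>(u, y). D y u)"
  proof (rule lborel_pair.Fubini_integrable)
    show "(\<lambda>(u, y). D y u) \<in> borel_measurable (lborel \<Otimes>\<^sub>M lborel)"
      unfolding D_def by measurable
    have i: "integrable lborel (\<lambda>y. h (y + c *\<^sub>R u) - h y)" for u
      using h integrable_translate[OF h] by simp
    then show "AE u in lborel. integrable lborel (\<lambda>y. case (u, y) of (u, y) \<Rightarrow> D y u)"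
      by (simp add: D_def)
    note le = L1_translation_error_le[OF h]
    have "integrable lborel (\<lambda>u. K u * (LINT y|lborel. cmod (h (y + c *\<^sub>R u) - h y)))"
      by (rule Bochner_Integration.integrable_bound[of _ "\<lambda>u. K u * (2 * (LINT y|lborel. cmod (h y)))"])
        (use iK K0 le in \<open>auto simp: abs_mult intro!: mult_left_mono\<close>)
    then show "integrable lborel (\<lambda>u. LINT y|lborel. norm (case (u, y) of (u, y) \<Rightarrow> D y u))"
      using K0 by (simp add: D_def norm_mult mult.commute)
  qed
  have D_int': "integrable (lborel \<Otimes>\<^sub>M lborel) (\<lambda>(y, u). D y u)"
    using lborel_pair.integrable_product_swap[OF D_int] by simp
  have Dy: "integrable lborel (\<lambda>y. LINT u|lborel. D y u)"
    by (rule lborel_pair.integrable_fst[OF D_int'])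
  have iG: "integrable (lborel \<Otimes>\<^sub>M lborel) (\<lambda>(x, y). h x * cnj (h y) * of_real (gauss_kernel (c\<^sup>2) (x - y)))"
    using integrable_gauss_autocorrelation[OF h c2] by (simp add: split_beta')
  have bnd: "integrable lborel (\<lambda>y. cnj (h y) * g y)" if "integrable lborel g" for g
  proof (rule Bochner_Integration.integrable_bound[of _ "\<lambda>y. C * cmod (g y)"])
    show "integrable lborel (\<lambda>y. C * cmod (g y))" using that by simp
    show "(\<lambda>y. cnj (h y) * g y) \<in> borel_measurable lborel"
      using borel_measurable_integrable[OF that] by measurable
    show "AE x in lborel. norm (cnj (h x) * g x) \<le> norm (C * cmod (g x))"
      using C C0 by (auto simp: norm_mult intro!: mult_right_mono)
  qed
  have "complex_of_real (LINT \<xi>|lborel. gaussian (c\<^sup>2) \<xi> * (cmod (fourier h \<xi>))\<^sup>2)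
      = (LINT w|(lborel \<Otimes>\<^sub>M lborel). (case w of (x, y) \<Rightarrow> h x * cnj (h y) * of_real (gauss_kernel (c\<^sup>2) (x - y))))"
    unfolding gaussian_energy_eq[OF h c2] by (simp add: split_beta')
  also have "\<dots> = (LINT y|lborel. (LINT x|lborel. h x * cnj (h y) * of_real (gauss_kernel (c\<^sup>2) (x - y))))"
    by (rule lborel_pair.integral_snd[OF iG, symmetric])
  also have "\<dots> = (LINT y|lborel. cnj (h y) * (LINT u|lborel. D y u) + cnj (h y) * h y)"
  proof (rule Bochner_Integration.integral_cong[OF refl])
    fix y
    have "(LINT x|lborel. h x * cnj (h y) * of_real (gauss_kernel (c\<^sup>2) (x - y)))
        = \<bar>c\<bar> ^ DIM('a) *\<^sub>R (LINT u|lborel. h (y + c *\<^sub>R u) * cnj (h y) * of_real (gauss_kernel (c\<^sup>2) ((y + c *\<^sub>R u) - y)))"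
      using c by (intro integral_lborel_affine) auto
    also have "\<dots> = (LINT u|lborel. \<bar>c\<bar> ^ DIM('a) *\<^sub>R (h (y + c *\<^sub>R u) * cnj (h y) * of_real (gauss_kernel (c\<^sup>2) ((y + c *\<^sub>R u) - y))))"
      by simp
    also have "\<dots> = (LINT u|lborel. cnj (h y) * (h (y + c *\<^sub>R u) * of_real (K u)))"
    proof (rule Bochner_Integration.integral_cong[OF refl])
      fix u
      have "complex_of_real (K u) = of_real (c ^ DIM('a)) * of_real (gauss_kernel (c\<^sup>2) (c *\<^sub>R u))"
        unfolding K_def gauss_kernel_scale[OF c, of u, symmetric] by simp
      then show "\<bar>c\<bar> ^ DIM('a) *\<^sub>R (h (y + c *\<^sub>R u) * cnj (h y) * of_real (gauss_kernel (c\<^sup>2) ((y + c *\<^sub>R u) - y)))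
          = cnj (h y) * (h (y + c *\<^sub>R u) * of_real (K u))"
        using c by (simp add: scaleR_conv_of_real)
    qed
    also have "\<dots> = cnj (h y) * (LINT u|lborel. h (y + c *\<^sub>R u) * of_real (K u))"
      by simp
    also have "(LINT u|lborel. h (y + c *\<^sub>R u) * of_real (K u)) = (LINT u|lborel. D y u + h y * of_real (K u))"
      by (simp add: D_def algebra_simps)
    also have "\<dots> = (LINT u|lborel. D y u) + h y"
    proof -
      have "integrable lborel (\<lambda>u. D y u)"
        unfolding D_def left_diff_distrib using hK[of y] iK by (intro Bochner_Integration.integrable_diff) auto
      then show ?thesis using iK by (subst Bochner_Integration.integral_add) auto
    qed
    finally show "(LINT x|lborel. h x * cnj (h y) * of_real (gauss_kernel (c\<^sup>2) (x - y)))
        = cnj (h y) * (LINT u|lborel. D y u) + cnj (h y) * h y"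
      by (simp add: algebra_simps)
  qed
  also have "\<dots> = (LINT y|lborel. cnj (h y) * (LINT u|lborel. D y u)) + (LINT y|lborel. cnj (h y) * h y)"
    by (intro Bochner_Integration.integral_add bnd Dy h)
  also have "(LINT y|lborel. cnj (h y) * h y) = of_real (LINT y|lborel. (cmod (h y))\<^sup>2)"
    by (subst integral_complex_of_real[symmetric]) (simp add: mult.commute complex_norm_square del: of_real_power)
  finally have eq: "complex_of_real ((LINT \<xi>|lborel. gaussian (c\<^sup>2) \<xi> * (cmod (fourier h \<xi>))\<^sup>2) - (LINT x|lborel. (cmod (h x))\<^sup>2))
      = (LINT y|lborel. cnj (h y) * (LINT u|lborel. D y u))"
    by simp
  have nD: "integrable (lborel \<Otimes>\<^sub>M lborel) (\<lambda>(y, u). cmod (D y u))"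
    using integrable_norm[OF D_int'] by (simp add: split_beta')
  have "\<bar>(LINT \<xi>|lborel. gaussian (c\<^sup>2) \<xi> * (cmod (fourier h \<xi>))\<^sup>2) - (LINT x|lborel. (cmod (h x))\<^sup>2)\<bar>
      = cmod (LINT y|lborel. cnj (h y) * (LINT u|lborel. D y u))"
    unfolding eq[symmetric] norm_of_real ..
  also have "\<dots> \<le> (LINT y|lborel. cmod (cnj (h y) * (LINT u|lborel. D y u)))"
    by (rule integral_norm_bound)
  also have "\<dots> \<le> (LINT y|lborel. C * (LINT u|lborel. cmod (D y u)))"
  proof (rule integral_mono)
    show "integrable lborel (\<lambda>y. cmod (cnj (h y) * (LINT u|lborel. D y u)))"
      by (intro integrable_norm bnd Dy)
    show "integrable lborel (\<lambda>y. C * (LINT u|lborel. cmod (D y u)))"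
      by (intro integrable_mult_right lborel_pair.integrable_fst[OF nD])
    show "cmod (cnj (h y) * (LINT u|lborel. D y u)) \<le> C * (LINT u|lborel. cmod (D y u))" for y
      using C C0 integral_norm_bound[of lborel "D y"] by (auto simp: norm_mult intro!: mult_mono)
  qed
  also have "\<dots> = C * (LINT y|lborel. (LINT u|lborel. cmod (D y u)))"
    by simp
  also have "(LINT y|lborel. (LINT u|lborel. cmod (D y u))) = (LINT u|lborel. (LINT y|lborel. cmod (D y u)))"
    by (rule lborel_pair.Fubini_integral[OF nD, symmetric])
  also have "\<dots> = (LINT u|lborel. gauss_kernel 1 u * (LINT y|lborel. cmod (h (y + c *\<^sub>R u) - h y)))"
    using K0 by (simp add: D_def norm_mult K_def mult.commute)
  finally show ?thesis .
qed

lemma integrable_norm_squared: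
  assumes "bounded_integrable h"
  shows "integrable lborel (\<lambda>x. (cmod (h x))\<^sup>2)"
proof -
  obtain C where h: "integrable lborel h" and C: "\<And>x. cmod (h x) \<le> C"
    using assms by (auto simp: bounded_integrable_def)
  have C0: "C \<ge> 0" using C[of 0] norm_ge_zero[of "h 0"] by linarith
  show ?thesis
    by (rule Bochner_Integration.integrable_bound[of _ "\<lambda>x. C * cmod (h x)"])
      (use h C C0 borel_measurable_integrable[OF h] in \<open>auto simp: power2_eq_square abs_mult intro!: mult_right_mono\<close>)
qed

text \<open>
  Let the Gaussian weight increase to 1 in \<open>gaussian_energy_eq\<close>. The left-hand side converges
  monotonically, and the right-hand side converges to the energy of \<open>h\<close> by \<open>gaussian_energy_error\<close>,
  continuity of translations and dominated convergence.
\<close>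

theorem plancherel:
  fixes h :: "'a::euclidean_space \<Rightarrow> complex"
  assumes "bounded_integrable h"
  shows "(\<integral>\<^sup>+\<xi>. ennreal ((cmod (fourier h \<xi>))\<^sup>2) \<partial>lborel) = (\<integral>\<^sup>+x. ennreal ((cmod (h x))\<^sup>2) \<partial>lborel)"
proof -
  obtain C where h: "integrable lborel h" and C: "\<And>x. cmod (h x) \<le> C"
    using assms by (auto simp: bounded_integrable_def)
  have [measurable]: "h \<in> borel_measurable borel" using borel_measurable_integrable[OF h] by simp
  define c where "c n = 1 / real (Suc n)" for n
  have c: "c n > 0" for n by (simp add: c_def)
  have c_lim: "c \<longlonglongrightarrow> 0" unfolding c_def by (rule LIMSEQ_Suc[OF lim_1_over_n])
  define Q where "Q n = (LINT \<xi>|lborel. gaussian ((c n)\<^sup>2) \<xi> * (cmod (fourier h \<xi>))\<^sup>2)" for n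
  define E where "E = (LINT x|lborel. (cmod (h x))\<^sup>2)"
  define T where "T z = (LINT y|lborel. cmod (h (y + z) - h y))" for z
  have [measurable]: "T \<in> borel_measurable borel" unfolding T_def by measurable
  have T: "T z \<ge> 0" "T z \<le> 2 * (LINT y|lborel. cmod (h y))" for z
    unfolding T_def using L1_translation_error_le[OF h] by auto
  have "(\<lambda>n. LINT u|lborel. gauss_kernel 1 u * T (c n *\<^sub>R u)) \<longlonglongrightarrow> (LINT u|(lborel :: 'a measure). 0)"
  proof (rule integral_dominated_convergence[where w="\<lambda>u. gauss_kernel 1 u * (2 * (LINT y|lborel. cmod (h y)))"])
    show "AE u in lborel. (\<lambda>n. gauss_kernel 1 u * T (c n *\<^sub>R u)) \<longlonglongrightarrow> 0"
    proof (rule AE_I2)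
      fix u :: 'a
      have "(\<lambda>n. c n *\<^sub>R u) \<longlonglongrightarrow> 0"
        using tendsto_scaleR[OF c_lim tendsto_const, of u] by simp
      then have "(\<lambda>n. T (c n *\<^sub>R u)) \<longlonglongrightarrow> 0"
        using L1_translation_continuous[OF h] unfolding translation_continuous_def T_def by simp
      then show "(\<lambda>n. gauss_kernel 1 u * T (c n *\<^sub>R u)) \<longlonglongrightarrow> 0"
        by (rule tendsto_mult_right_zero)
    qed
    show "integrable lborel (\<lambda>u::'a. gauss_kernel 1 u * (2 * (LINT y|lborel. cmod (h y))))"
      by (intro integrable_mult_left integrable_gauss_kernel) simp
    show "AE u in lborel. norm (gauss_kernel 1 u * T (c n *\<^sub>R u)) \<le> gauss_kernel 1 u * (2 * (LINT y|lborel. cmod (h y)))" for n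
      using T by (intro AE_I2) (auto simp: abs_mult abs_of_nonneg[OF gauss_kernel_nonneg] gauss_kernel_nonneg intro!: mult_left_mono)
  qed measurable
  then have err: "(\<lambda>n. C * (LINT u|lborel. gauss_kernel 1 u * T (c n *\<^sub>R u))) \<longlonglongrightarrow> 0"
    by (intro tendsto_mult_right_zero) simp
  have "(\<lambda>n. Q n - E) \<longlonglongrightarrow> 0"
    by (rule Lim_null_comparison[OF _ err])
      (use gaussian_energy_error[OF h C c] in \<open>auto simp: Q_def E_def T_def\<close>)
  then have "Q \<longlonglongrightarrow> E" by (simp add: LIM_zero_iff)
  then have lim1: "(\<lambda>n. ennreal (Q n)) \<longlonglongrightarrow> ennreal E"
    by (rule tendsto_ennrealI)
  have Qn: "ennreal (Q n) = (\<integral>\<^sup>+\<xi>. ennreal (gaussian ((c n)\<^sup>2) \<xi> * (cmod (fourier h \<xi>))\<^sup>2) \<partial>lborel)" for n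
    unfolding Q_def using c[of n]
    by (intro nn_integral_eq_integral[symmetric] integrable_gaussian_fourier[OF h])
      (auto intro!: mult_nonneg_nonneg less_imp_le[OF gaussian_pos])
  have "(\<lambda>n. \<integral>\<^sup>+\<xi>. ennreal (gaussian ((c n)\<^sup>2) \<xi> * (cmod (fourier h \<xi>))\<^sup>2) \<partial>lborel)
      \<longlonglongrightarrow> (\<integral>\<^sup>+\<xi>. ennreal ((cmod (fourier h \<xi>))\<^sup>2) \<partial>lborel)"
  proof (rule nn_integral_LIMSEQ)
    have cmono: "(c n)\<^sup>2 \<le> (c m)\<^sup>2" if "m \<le> n" for m n
      using that by (intro power_mono) (auto simp: c_def field_simps)
    show "incseq (\<lambda>n \<xi>. ennreal (gaussian ((c n)\<^sup>2) \<xi> * (cmod (fourier h \<xi>))\<^sup>2))"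
      unfolding incseq_def le_fun_def gaussian_def
      using cmono by (auto intro!: ennreal_leI mult_right_mono)
    show "(\<lambda>n. ennreal (gaussian ((c n)\<^sup>2) \<xi> * (cmod (fourier h \<xi>))\<^sup>2)) \<longlonglongrightarrow> ennreal ((cmod (fourier h \<xi>))\<^sup>2)" for \<xi>
    proof (rule tendsto_ennrealI)
      have "(\<lambda>n. exp (- (c n)\<^sup>2 * (norm \<xi>)\<^sup>2) * (cmod (fourier h \<xi>))\<^sup>2) \<longlonglongrightarrow> exp (- 0\<^sup>2 * (norm \<xi>)\<^sup>2) * (cmod (fourier h \<xi>))\<^sup>2"
        by (intro tendsto_mult tendsto_exp tendsto_minus tendsto_power c_lim tendsto_const)
      then show "(\<lambda>n. gaussian ((c n)\<^sup>2) \<xi> * (cmod (fourier h \<xi>))\<^sup>2) \<longlonglongrightarrow> (cmod (fourier h \<xi>))\<^sup>2"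
        by (simp add: gaussian_def)
    qed
  qed measurable
  with lim1 have "(\<integral>\<^sup>+\<xi>. ennreal ((cmod (fourier h \<xi>))\<^sup>2) \<partial>lborel) = ennreal E"
    unfolding Qn by (rule LIMSEQ_unique[rotated])
  also have "ennreal E = (\<integral>\<^sup>+x. ennreal ((cmod (h x))\<^sup>2) \<partial>lborel)"
    unfolding E_def by (intro nn_integral_eq_integral[symmetric] integrable_norm_squared assms) auto
  finally show ?thesis .
qed

section \<open>Convolution\<close>

lemma conv_lborel:
  assumes [measurable]: "f \<in> borel_measurable borel" "g \<in> borel_measurable borel"
  shows "conv f g x = (LINT y|lborel. f y * g (x - y))"
proof -
  have "(\<lambda>y. f y * g (x - y)) \<in> borel_measurable lborel" by measurable
  then show ?thesis
    unfolding conv_def by (rule integral_completion)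
qed

lemma conv_measurable:
  assumes [measurable]: "f \<in> borel_measurable borel" "g \<in> borel_measurable borel"
  shows "conv f g \<in> borel_measurable borel"
proof -
  have "conv f g = (\<lambda>x. LINT y|lborel. f y * g (x - y))"
    by (rule ext) (rule conv_lborel[OF assms])
  then show ?thesis by simp
qed

lemma
  fixes f :: "'a::euclidean_space \<Rightarrow> 'b::{banach, second_countable_topology}"
  assumes f: "integrable lborel f"
  shows integrable_reflect: "integrable lborel (\<lambda>y. f (x - y))"
    and integral_reflect: "(LINT y|lborel. f (x - y)) = integral\<^sup>L lborel f"
  using integrable_lborel_affine[OF f, of "-1" x] integral_lborel_affine[of f "-1" x]
    borel_measurable_integrable[OF f] by simp_all

lemma integrable_conv_pair:
  fixes f g :: "'a::euclidean_space \<Rightarrow> complex"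
  assumes f: "integrable lborel f" and g: "integrable lborel g"
  shows "integrable (lborel \<Otimes>\<^sub>M lborel) (\<lambda>(y, x). f y * g (x - y))"
proof (rule lborel_pair.Fubini_integrable)
  have [measurable]: "f \<in> borel_measurable borel" "g \<in> borel_measurable borel"
    using f g by auto
  show "(\<lambda>(y, x). f y * g (x - y)) \<in> borel_measurable (lborel \<Otimes>\<^sub>M lborel)"
    by measurable
  have g': "integrable lborel (\<lambda>x. g (x - y))" "(LINT x|lborel. cmod (g (x - y))) = (LINT x|lborel. cmod (g x))" for y
    using integrable_translate[OF g, of "- y"] integral_translate[of "\<lambda>x. cmod (g x)" "- y"] by simp_all
  show "integrable lborel (\<lambda>y. LINT x|lborel. norm (case (y, x) of (y, x) \<Rightarrow> f y * g (x - y)))"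
    using f by (simp add: norm_mult g')
  show "AE y in lborel. integrable lborel (\<lambda>x. case (y, x) of (y, x) \<Rightarrow> f y * g (x - y))"
    using g' by simp
qed

lemma bounded_integrable_conv:
  fixes f g :: "'a::euclidean_space \<Rightarrow> complex"
  assumes f: "bounded_integrable f" and g: "integrable lborel g"
  shows "bounded_integrable (conv f g)"
proof -
  obtain C where f': "integrable lborel f" and C: "\<And>x. cmod (f x) \<le> C"
    using f by (auto simp: bounded_integrable_def)
  have m[measurable]: "f \<in> borel_measurable borel" "g \<in> borel_measurable borel"
    using f' g by auto
  have conv: "conv f g = (\<lambda>x. LINT y|lborel. f y * g (x - y))"
    by (rule ext) (rule conv_lborel[OF m])
  have "integrable lborel (conv f g)"
    unfolding conv by (rule lborel_pair.integrable_snd[OF integrable_conv_pair[OF f' g]])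
  moreover have "cmod (conv f g x) \<le> C * (LINT y|lborel. cmod (g y))" for x
  proof -
    have gi: "integrable lborel (\<lambda>y. C * cmod (g (x - y)))"
      using integrable_reflect[OF g] by simp
    have le: "cmod (f y * g (x - y)) \<le> C * cmod (g (x - y))" for y
      using C by (simp add: norm_mult mult_right_mono)
    have "cmod (conv f g x) \<le> (LINT y|lborel. cmod (f y * g (x - y)))"
      unfolding conv by (rule integral_norm_bound)
    also have "\<dots> \<le> (LINT y|lborel. C * cmod (g (x - y)))"
    proof (rule integral_mono[OF _ gi le])
      show "integrable lborel (\<lambda>y. cmod (f y * g (x - y)))"
        by (rule Bochner_Integration.integrable_bound[OF gi]) (use le in \<open>auto intro: order_trans[OF _ abs_ge_self]\<close>)
    qed
    also have "\<dots> = C * (LINT y|lborel. cmod (g y))"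
      using integral_reflect[OF integrable_norm[OF g], of x] by simp
    finally show ?thesis .
  qed
  ultimately show ?thesis
    by (auto simp: bounded_integrable_def)
qed

lemma fourier_conv:
  fixes f g :: "'a::euclidean_space \<Rightarrow> complex"
  assumes f: "integrable lborel f" and g: "integrable lborel g"
  shows "fourier (conv f g) \<xi> = fourier f \<xi> * fourier g \<xi>"
proof -
  have m[measurable]: "f \<in> borel_measurable borel" "g \<in> borel_measurable borel"
    using f g by auto
  let ?f = "\<lambda>y. f y * character \<xi> y" and ?g = "\<lambda>y. g y * character \<xi> y"
  have i: "integrable (lborel \<Otimes>\<^sub>M lborel) (\<lambda>(y, x). ?f y * ?g (x - y))"
    by (rule integrable_conv_pair[OF integrable_mult_character[OF f] integrable_mult_character[OF g]])
  have "fourier (conv f g) \<xi> = (LINT x|lborel. (LINT y|lborel. f y * g (x - y)) * character \<xi> x)"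
    by (subst fourier_lborel[OF conv_measurable[OF m]]) (simp add: conv_lborel)
  also have "\<dots> = (LINT x|lborel. (LINT y|lborel. ?f y * ?g (x - y)))"
  proof (rule Bochner_Integration.integral_cong[OF refl])
    fix x
    have c: "character \<xi> y * character \<xi> (x - y) = character \<xi> x" for y
      unfolding character_add[symmetric] by simp
    have "(LINT y|lborel. f y * g (x - y)) * character \<xi> x = (LINT y|lborel. (f y * g (x - y)) * character \<xi> x)"
      by simp
    also have "\<dots> = (LINT y|lborel. ?f y * ?g (x - y))"
      by (rule Bochner_Integration.integral_cong) (simp_all add: c[symmetric])
    finally show "(LINT y|lborel. f y * g (x - y)) * character \<xi> x = (LINT y|lborel. ?f y * ?g (x - y))" .
  qed
  also have "\<dots> = (LINT y|lborel. (LINT x|lborel. ?f y * ?g (x - y)))"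
    by (rule lborel_pair.Fubini_integral[OF i])
  also have "\<dots> = (LINT y|lborel. ?f y * (LINT x|lborel. ?g (x - y)))"
    by simp
  also have "\<dots> = (LINT y|lborel. ?f y * integral\<^sup>L lborel ?g)"
    using integral_translate[of ?g "- y" for y] by simp
  also have "\<dots> = fourier f \<xi> * fourier g \<xi>"
    by (simp add: fourier_lborel)
  finally show ?thesis .
qed

section \<open>Sums of extended nonnegative reals over paths\<close>

text \<open>
  Unordered sums are turned into integrals against counting measure, for which monotone
  convergence, Fatou's lemma and Tonelli's theorem are at hand.
\<close>

lemma infsum_ennreal_eq_nn_integral:
  fixes f :: "'b \<Rightarrow> ennreal"
  assumes A: "countable A"
  shows "(\<Sum>\<^sub>\<infinity>x\<in>A. f x) = (\<integral>\<^sup>+x. f x \<partial>count_space A)"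
proof -
  have inf: "(\<Sum>\<^sub>\<infinity>x\<in>A. f x) = (SUP F\<in>{F. finite F \<and> F \<subseteq> A}. sum f F)"
    by (rule nonneg_infsum_complete) simp
  have fin: "(\<integral>\<^sup>+x. f x * indicator F x \<partial>count_space A) = sum f F" if "finite F" "F \<subseteq> A" for F
  proof -
    have "(\<integral>\<^sup>+x. f x * indicator F x \<partial>count_space A) = (\<integral>\<^sup>+x. f x \<partial>count_space F)"
      using that by (simp add: nn_integral_count_space_indicator indicator_def)
        (auto intro!: nn_integral_cong simp: indicator_def)
    then show ?thesis using that by (simp add: nn_integral_count_space_finite)
  qed
  show ?thesis
  proof (rule antisym)
    show "(\<Sum>\<^sub>\<infinity>x\<in>A. f x) \<le> (\<integral>\<^sup>+x. f x \<partial>count_space A)"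
      unfolding inf
    proof (rule SUP_least)
      fix F assume "F \<in> {F. finite F \<and> F \<subseteq> A}"
      then have "sum f F = (\<integral>\<^sup>+x. f x * indicator F x \<partial>count_space A)" using fin by simp
      also have "\<dots> \<le> (\<integral>\<^sup>+x. f x \<partial>count_space A)"
        by (intro nn_integral_mono) (auto simp: indicator_def)
      finally show "sum f F \<le> (\<integral>\<^sup>+x. f x \<partial>count_space A)" .
    qed
    define B where "B n = {x \<in> A. to_nat_on A x < n}" for n
    have B: "finite (B n)" "B n \<subseteq> A" for n
    proof -
      show "finite (B n)"
        using inj_on_subset[OF inj_on_to_nat_on[OF A], of "B n"]
        by (intro inj_on_finite[of "to_nat_on A" _ "{..<n}"]) (auto simp: B_def)
    qed (auto simp: B_def)
    have "(\<lambda>n. \<integral>\<^sup>+x. f x * indicator (B n) x \<partial>count_space A) \<longlonglongrightarrow> (\<integral>\<^sup>+x. f x * indicator A x \<partial>count_space A)"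
    proof (rule nn_integral_LIMSEQ)
      show "incseq (\<lambda>n x. f x * indicator (B n) x)"
        by (auto simp: incseq_def le_fun_def B_def indicator_def)
      show "(\<lambda>n. f x * indicator (B n) x) \<longlonglongrightarrow> f x * indicator A x" for x
      proof (rule tendsto_eventually)
        show "\<forall>\<^sub>F n in sequentially. f x * indicator (B n) x = f x * indicator A x"
          using eventually_gt_at_top[of "to_nat_on A x"]
          by eventually_elim (auto simp: B_def indicator_def)
      qed
    qed simp
    moreover have "(\<integral>\<^sup>+x. f x * indicator A x \<partial>count_space A) = (\<integral>\<^sup>+x. f x \<partial>count_space A)"
      by (intro nn_integral_cong) simp
    ultimately show "(\<integral>\<^sup>+x. f x \<partial>count_space A) \<le> (\<Sum>\<^sub>\<infinity>x\<in>A. f x)"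
      by (intro LIMSEQ_le_const2[of _ "\<integral>\<^sup>+x. f x \<partial>count_space A"])
        (auto simp: inf fin[OF B] intro!: SUP_upper B)
  qed
qed

lemma nn_integral_count_space_times:
  fixes f :: "'b \<times> 'c \<Rightarrow> ennreal"
  assumes "countable A" "countable B"
  shows "(\<integral>\<^sup>+w. f w \<partial>count_space (A \<times> B)) = (\<integral>\<^sup>+x. \<integral>\<^sup>+y. f (x, y) \<partial>count_space B \<partial>count_space A)"
proof -
  interpret sigma_finite_measure "count_space B"
    by (rule sigma_finite_measure_count_space_countable[OF assms(2)])
  have "(\<integral>\<^sup>+x. \<integral>\<^sup>+y. f (x, y) \<partial>count_space B \<partial>count_space A) = nn_integral (count_space A \<Otimes>\<^sub>M count_space B) f"
    by (rule nn_integral_fst) (simp add: pair_measure_countable[OF assms])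
  then show ?thesis by (simp add: pair_measure_countable[OF assms])
qed

lemma countable_paths: "countable \<Lambda> \<Longrightarrow> countable (paths_of_length \<Lambda> N)"
  unfolding paths_of_length_def
  by (rule countable_subset[OF _ countable_lists]) (auto simp: lists_eq_set)

lemma paths_0: "paths_of_length \<Lambda> 0 = {[]}"
  by (auto simp: paths_of_length_def)

text \<open>
  Paths are extended at their end: the last filter of a path is the one that is applied last, so
  the next layer arises from the present one by one more step of the cascade.
\<close>

lemma bij_betw_paths_Suc:
  "bij_betw (\<lambda>(p, l). p @ [l]) (paths_of_length \<Lambda> N \<times> \<Lambda>) (paths_of_length \<Lambda> (Suc N))"
proof (rule bij_betwI'[of])
  fix q assume "q \<in> paths_of_length \<Lambda> (Suc N)"
  then have "q \<noteq> []" "set q \<subseteq> \<Lambda>" "length q = Suc N" by (auto simp: paths_of_length_def)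
  then show "\<exists>x\<in>paths_of_length \<Lambda> N \<times> \<Lambda>. q = (case x of (p, l) \<Rightarrow> p @ [l])"
    by (intro bexI[of _ "(butlast q, last q)"]) (auto simp: paths_of_length_def dest: in_set_butlastD)
qed (auto simp: paths_of_length_def)

lemma sum_paths_Suc:
  fixes F :: "'l list \<Rightarrow> ennreal"
  assumes "countable \<Lambda>"
  shows "(\<integral>\<^sup>+q. F q \<partial>count_space (paths_of_length \<Lambda> (Suc N)))
    = (\<integral>\<^sup>+p. \<integral>\<^sup>+l. F (p @ [l]) \<partial>count_space \<Lambda> \<partial>count_space (paths_of_length \<Lambda> N))"
  using nn_integral_bij_count_space[OF bij_betw_paths_Suc[where \<Lambda>=\<Lambda> and N=N], where f=F]
    nn_integral_count_space_times[OF countable_paths[OF assms] assms, where f="\<lambda>(p, l). F (p @ [l])"]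
  by (simp add: split_beta')

lemma sum_paths_0:
  fixes F :: "'l list \<Rightarrow> ennreal"
  shows "(\<integral>\<^sup>+q. F q \<partial>count_space (paths_of_length \<Lambda> 0)) = F []"
  by (simp add: paths_0 nn_integral_count_space_finite)

lemma scat_U_snoc: "scat_U \<psi> (p @ [l]) f = scat_U1 \<psi> l (scat_U \<psi> p f)"
  by (induction p arbitrary: f) auto

section \<open>Energy at low and at high frequencies\<close>

definition energy :: "('a::euclidean_space \<Rightarrow> complex) \<Rightarrow> ennreal" where
  "energy f = (\<integral>\<^sup>+x. ennreal ((cmod (f x))\<^sup>2) \<partial>lborel)"

definition spectral_energy :: "('a::euclidean_space \<Rightarrow> real) \<Rightarrow> ('a \<Rightarrow> complex) \<Rightarrow> ennreal" where
  "spectral_energy w f = (\<integral>\<^sup>+\<xi>. ennreal (w \<xi> * (cmod (fourier f \<xi>))\<^sup>2) \<partial>lborel)"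

abbreviation low_energy :: "real \<Rightarrow> ('a::euclidean_space \<Rightarrow> complex) \<Rightarrow> ennreal" where
  "low_energy s \<equiv> spectral_energy (gaussian s)"

abbreviation high_energy :: "real \<Rightarrow> ('a::euclidean_space \<Rightarrow> complex) \<Rightarrow> ennreal" where
  "high_energy s \<equiv> spectral_energy (\<lambda>\<xi>. 1 - gaussian s \<xi>)"

abbreviation modulus :: "('a \<Rightarrow> complex) \<Rightarrow> 'a \<Rightarrow> complex" where
  "modulus f \<equiv> (\<lambda>x. complex_of_real (cmod (f x)))"

lemma bounded_integrableD:
  assumes "bounded_integrable f"
  shows "integrable lborel f" "f \<in> borel_measurable borel"
  using assms by (auto simp: bounded_integrable_def)

lemma bounded_integrable_modulus: "bounded_integrable f \<Longrightarrow> bounded_integrable (modulus f)"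
  by (auto simp: bounded_integrable_def)

lemma energy_modulus [simp]: "energy (modulus f) = energy f"
  by (simp add: energy_def)

lemma energy_finite: "bounded_integrable f \<Longrightarrow> energy f < \<infinity>"
  using integrable_norm_squared[of f] by (auto simp: energy_def integrable_iff_bounded)

lemma spectral_energy_one: "bounded_integrable f \<Longrightarrow> spectral_energy (\<lambda>_. 1) f = energy f"
  by (simp add: spectral_energy_def energy_def plancherel)

lemma spectral_energy_mono:
  "(\<And>\<xi>. w \<xi> \<le> w' \<xi>) \<Longrightarrow> spectral_energy w f \<le> spectral_energy w' f"
  unfolding spectral_energy_def by (intro nn_integral_mono ennreal_leI mult_right_mono) auto

lemma low_energy_le:
  assumes "bounded_integrable f" "s \<ge> 0"
  shows "low_energy s f \<le> energy f"
  unfolding spectral_energy_one[OF assms(1), symmetric]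
  by (rule spectral_energy_mono) (simp add: gaussian_le_1[OF assms(2)])

lemma low_plus_high:
  assumes f: "bounded_integrable f" and s: "s \<ge> 0"
  shows "low_energy s f + high_energy s f = energy f"
proof -
  note bounded_integrableD(2)[OF f, measurable]
  have "low_energy s f + high_energy s f
      = (\<integral>\<^sup>+\<xi>. ennreal (gaussian s \<xi> * (cmod (fourier f \<xi>))\<^sup>2) + ennreal ((1 - gaussian s \<xi>) * (cmod (fourier f \<xi>))\<^sup>2) \<partial>lborel)"
    unfolding spectral_energy_def by (intro nn_integral_add[symmetric]) auto
  also have "\<dots> = spectral_energy (\<lambda>_. 1) f"
    unfolding spectral_energy_def
  proof (rule nn_integral_cong)
    fix \<xi> :: 'a
    have "gaussian s \<xi> * (cmod (fourier f \<xi>))\<^sup>2 \<ge> 0" "(1 - gaussian s \<xi>) * (cmod (fourier f \<xi>))\<^sup>2 \<ge> 0"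
      using gaussian_le_1[OF s, of \<xi>] less_imp_le[OF gaussian_pos, of s \<xi>] by auto
    then show "ennreal (gaussian s \<xi> * (cmod (fourier f \<xi>))\<^sup>2) + ennreal ((1 - gaussian s \<xi>) * (cmod (fourier f \<xi>))\<^sup>2)
        = ennreal (1 * (cmod (fourier f \<xi>))\<^sup>2)"
      by (simp add: ennreal_plus[symmetric] algebra_simps del: ennreal_plus)
  qed
  finally show ?thesis by (simp add: spectral_energy_one[OF f])
qed

lemma low_energy_integral:
  assumes "integrable lborel f" "s > 0"
  shows "low_energy s f = ennreal (LINT \<xi>|lborel. gaussian s \<xi> * (cmod (fourier f \<xi>))\<^sup>2)"
  unfolding spectral_energy_def using assms
  by (intro nn_integral_eq_integral integrable_gaussian_fourier)
    (auto intro!: mult_nonneg_nonneg less_imp_le[OF gaussian_pos])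

lemma low_energy_modulus:
  fixes f :: "'a::euclidean_space \<Rightarrow> complex"
  assumes f: "bounded_integrable f" and s: "0 < s'" "s' \<le> s"
  shows "low_energy s' f \<le> ennreal (sqrt (s / s') ^ DIM('a)) * low_energy s (modulus f)"
proof -
  note i = bounded_integrableD(1)[OF f]
  have "integrable lborel (modulus f)" using i by simp
  then show ?thesis
    using gaussian_energy_modulus[OF i s] s i
    by (simp add: low_energy_integral ennreal_leI ennreal_mult'[symmetric])
qed

text \<open>
  The total energies of \<open>f\<close> and of its modulus agree, so what the modulus gains at low frequencies it
  loses at high ones.
\<close>

lemma high_energy_modulus:
  assumes f: "bounded_integrable f" and s: "s > 0"
  shows "high_energy s (modulus f) \<le> high_energy s f"
proof -
  have le: "low_energy s f \<le> low_energy s (modulus f)"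
    using low_energy_modulus[OF f s order_refl] s by simp
  have fm: "bounded_integrable (modulus f)" by (rule bounded_integrable_modulus[OF f])
  have fin: "low_energy s (modulus f) \<noteq> top"
    using low_energy_le[OF fm less_imp_le[OF s]] energy_finite[OF fm] by (auto simp: top_unique)
  have "low_energy s (modulus f) + high_energy s (modulus f) = low_energy s f + high_energy s f"
    using low_plus_high[OF f less_imp_le[OF s]] low_plus_high[OF fm less_imp_le[OF s]] by simp
  also have "\<dots> \<le> low_energy s (modulus f) + high_energy s f"
    by (rule add_right_mono[OF le])
  finally show ?thesis
    using fin by (simp add: ennreal_add_left_cancel_le)
qed

lemma high_energy_tendsto_0:
  assumes f: "bounded_integrable f"
  shows "(\<lambda>n. high_energy (1 / real (Suc n)) f) \<longlonglongrightarrow> 0"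
proof -
  note bounded_integrableD(2)[OF f, measurable]
  have "(\<lambda>n. \<integral>\<^sup>+\<xi>. ennreal ((1 - gaussian (1 / real (Suc n)) \<xi>) * (cmod (fourier f \<xi>))\<^sup>2) \<partial>lborel)
      \<longlonglongrightarrow> (\<integral>\<^sup>+(\<xi>::'a). 0 \<partial>lborel)"
  proof (rule nn_integral_dominated_convergence[where w="\<lambda>\<xi>. ennreal ((cmod (fourier f \<xi>))\<^sup>2)"])
    show "AE \<xi> in lborel. ennreal ((1 - gaussian (1 / real (Suc n)) \<xi>) * (cmod (fourier f \<xi>))\<^sup>2) \<le> ennreal ((cmod (fourier f \<xi>))\<^sup>2)" for n
      using less_imp_le[OF gaussian_pos] by (intro AE_I2 ennreal_leI mult_left_le_one_le) (auto simp: gaussian_le_1)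
    show "(\<integral>\<^sup>+\<xi>. ennreal ((cmod (fourier f \<xi>))\<^sup>2) \<partial>lborel) < \<infinity>"
      using energy_finite[OF f] unfolding energy_def plancherel[OF f, symmetric] .
    show "AE \<xi> in lborel. (\<lambda>n. ennreal ((1 - gaussian (1 / real (Suc n)) \<xi>) * (cmod (fourier f \<xi>))\<^sup>2)) \<longlonglongrightarrow> 0"
    proof (rule AE_I2)
      fix \<xi> :: 'a
      have "(\<lambda>n. (1 - exp (- (1 / real (Suc n)) * (norm \<xi>)\<^sup>2)) * (cmod (fourier f \<xi>))\<^sup>2)
          \<longlonglongrightarrow> (1 - exp (- 0 * (norm \<xi>)\<^sup>2)) * (cmod (fourier f \<xi>))\<^sup>2"
        by (intro tendsto_mult tendsto_diff tendsto_exp tendsto_minus tendsto_const LIMSEQ_Suc[OF lim_1_over_n])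
      then have "(\<lambda>n. (1 - gaussian (1 / real (Suc n)) \<xi>) * (cmod (fourier f \<xi>))\<^sup>2) \<longlonglongrightarrow> 0"
        by (simp add: gaussian_def)
      from tendsto_ennrealI[OF this]
      show "(\<lambda>n. ennreal ((1 - gaussian (1 / real (Suc n)) \<xi>) * (cmod (fourier f \<xi>))\<^sup>2)) \<longlonglongrightarrow> 0"
        by simp
    qed
  qed measurable
  then show ?thesis by (simp add: spectral_energy_def)
qed

section \<open>One step of the scattering cascade for bounded integrable functions\<close>

text \<open>
  A scattering filter bank whose filters are Borel functions. Borel measurability makes functions of
  \<open>x - y\<close> measurable for the product of two Lebesgue measures, as Fubini's theorem demands.
\<close>

locale borel_filter_bank =
  fixes \<phi> :: "'a::euclidean_space \<Rightarrow> complex" and \<Lambda> :: "'l set" and \<psi> :: "'l \<Rightarrow> 'a \<Rightarrow> complex"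
  assumes countable: "countable \<Lambda>"
    and \<phi>: "integrable lborel \<phi>" "energy \<phi> < \<infinity>"
    and \<psi>: "\<And>l. l \<in> \<Lambda> \<Longrightarrow> integrable lborel (\<psi> l)" "\<And>l. l \<in> \<Lambda> \<Longrightarrow> energy (\<psi> l) < \<infinity>"
    and tight: "AE \<xi> in lborel. ennreal ((cmod (fourier \<phi> \<xi>))\<^sup>2)
      + (\<integral>\<^sup>+l. ennreal ((cmod (fourier (\<psi> l) \<xi>))\<^sup>2) \<partial>count_space \<Lambda>) = 1"
    and low_pass: "fourier \<phi> 0 \<noteq> 0"
begin

lemma \<phi>_measurable [measurable]: "\<phi> \<in> borel_measurable borel"
  using \<phi>(1) by auto

lemma \<psi>_measurable: "l \<in> \<Lambda> \<Longrightarrow> \<psi> l \<in> borel_measurable borel"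
  using \<psi>(1) by auto

text \<open>
  Multiply the identity \<open>tight\<close> by the weighted squared transform of \<open>g\<close> and integrate; convolution
  becomes multiplication of transforms.
\<close>

lemma spectral_energy_split:
  assumes g: "bounded_integrable g" and w: "\<And>\<xi>. w \<xi> \<ge> 0" and [measurable]: "w \<in> borel_measurable borel"
  shows "spectral_energy w g = spectral_energy w (conv g \<phi>)
    + (\<integral>\<^sup>+l. spectral_energy w (conv g (\<psi> l)) \<partial>count_space \<Lambda>)"
proof -
  note bounded_integrableD(2)[OF g, measurable]
  define G where "G \<xi> = ennreal (w \<xi> * (cmod (fourier g \<xi>))\<^sup>2)" for \<xi>
  have [measurable]: "G \<in> borel_measurable borel" unfolding G_def by measurable
  have F: "spectral_energy w (conv g h) = (\<integral>\<^sup>+\<xi>. G \<xi> * ennreal ((cmod (fourier h \<xi>))\<^sup>2) \<partial>lborel)"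
    if "integrable lborel h" for h
    unfolding spectral_energy_def G_def fourier_conv[OF bounded_integrableD(1)[OF g] that]
    using w by (simp add: norm_mult power_mult_distrib ennreal_mult' ennreal_mult'' mult.assoc)
  have "spectral_energy w g = (\<integral>\<^sup>+\<xi>. G \<xi> * ennreal ((cmod (fourier \<phi> \<xi>))\<^sup>2)
      + (\<integral>\<^sup>+l. G \<xi> * ennreal ((cmod (fourier (\<psi> l) \<xi>))\<^sup>2) \<partial>count_space \<Lambda>) \<partial>lborel)"
    unfolding spectral_energy_def G_def[symmetric]
  proof (rule nn_integral_cong_AE)
    show "AE \<xi> in lborel. G \<xi> = G \<xi> * ennreal ((cmod (fourier \<phi> \<xi>))\<^sup>2)
        + (\<integral>\<^sup>+l. G \<xi> * ennreal ((cmod (fourier (\<psi> l) \<xi>))\<^sup>2) \<partial>count_space \<Lambda>)"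
      using tight
    proof eventually_elim
      case (elim \<xi>)
      have "(\<integral>\<^sup>+l. G \<xi> * ennreal ((cmod (fourier (\<psi> l) \<xi>))\<^sup>2) \<partial>count_space \<Lambda>)
          = G \<xi> * (\<integral>\<^sup>+l. ennreal ((cmod (fourier (\<psi> l) \<xi>))\<^sup>2) \<partial>count_space \<Lambda>)"
        by (rule nn_integral_cmult) simp
      then show ?case
        unfolding distrib_left[symmetric] elim[symmetric] by (simp add: distrib_left[symmetric] elim)
    qed
  qed
  also have "\<dots> = (\<integral>\<^sup>+\<xi>. G \<xi> * ennreal ((cmod (fourier \<phi> \<xi>))\<^sup>2) \<partial>lborel)
      + (\<integral>\<^sup>+\<xi>. (\<integral>\<^sup>+l. G \<xi> * ennreal ((cmod (fourier (\<psi> l) \<xi>))\<^sup>2) \<partial>count_space \<Lambda>) \<partial>lborel)"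
  proof (rule nn_integral_add)
    show "(\<lambda>\<xi>. \<integral>\<^sup>+l. G \<xi> * ennreal ((cmod (fourier (\<psi> l) \<xi>))\<^sup>2) \<partial>count_space \<Lambda>) \<in> borel_measurable lborel"
    proof -
      interpret sigma_finite_measure "count_space \<Lambda>"
        by (rule sigma_finite_measure_count_space_countable[OF countable])
      show ?thesis
      proof (rule borel_measurable_nn_integral)
        have "(\<lambda>(l, \<xi>). G \<xi> * ennreal ((cmod (fourier (\<psi> l) \<xi>))\<^sup>2)) \<in> borel_measurable (count_space \<Lambda> \<Otimes>\<^sub>M lborel)"
        proof (rule measurable_pair_measure_countable1[OF countable])
          fix l assume "l \<in> \<Lambda>"
          then have [measurable]: "\<psi> l \<in> borel_measurable borel" by (rule \<psi>_measurable)
          show "(\<lambda>\<xi>. case (l, \<xi>) of (l, \<xi>) \<Rightarrow> G \<xi> * ennreal ((cmod (fourier (\<psi> l) \<xi>))\<^sup>2)) \<in> borel_measurable lborel"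
            unfolding prod.case by measurable
        qed
        from measurable_compose[OF measurable_pair_swap' this]
        show "(\<lambda>(\<xi>, l). G \<xi> * ennreal ((cmod (fourier (\<psi> l) \<xi>))\<^sup>2)) \<in> borel_measurable (lborel \<Otimes>\<^sub>M count_space \<Lambda>)"
          by (simp add: split_beta')
      qed
    qed
  qed measurable
  also have "(\<integral>\<^sup>+\<xi>. (\<integral>\<^sup>+l. G \<xi> * ennreal ((cmod (fourier (\<psi> l) \<xi>))\<^sup>2) \<partial>count_space \<Lambda>) \<partial>lborel)
      = (\<integral>\<^sup>+l. (\<integral>\<^sup>+\<xi>. G \<xi> * ennreal ((cmod (fourier (\<psi> l) \<xi>))\<^sup>2) \<partial>lborel) \<partial>count_space \<Lambda>)"
  proof (rule nn_integral_count_space_nn_integral[OF countable])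
    fix l assume "l \<in> \<Lambda>"
    then have [measurable]: "\<psi> l \<in> borel_measurable borel" by (rule \<psi>_measurable)
    show "(\<lambda>\<xi>. G \<xi> * ennreal ((cmod (fourier (\<psi> l) \<xi>))\<^sup>2)) \<in> borel_measurable lborel"
      by measurable
  qed
  also have "\<dots> = (\<integral>\<^sup>+l. spectral_energy w (conv g (\<psi> l)) \<partial>count_space \<Lambda>)"
    by (intro nn_integral_cong) (simp add: F \<psi>)
  finally show ?thesis by (simp add: F \<phi>)
qed

lemma bounded_integrable_conv_\<phi>: "bounded_integrable g \<Longrightarrow> bounded_integrable (conv g \<phi>)"
  by (rule bounded_integrable_conv[OF _ \<phi>(1)])

lemma bounded_integrable_conv_\<psi>: "bounded_integrable g \<Longrightarrow> l \<in> \<Lambda> \<Longrightarrow> bounded_integrable (conv g (\<psi> l))"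
  by (rule bounded_integrable_conv[OF _ \<psi>(1)])

lemma bounded_integrable_scat_U:
  assumes "bounded_integrable f" "set p \<subseteq> \<Lambda>"
  shows "bounded_integrable (scat_U \<psi> p f)"
  using assms
  by (induction p arbitrary: f)
    (auto simp: scat_U1_def intro!: bounded_integrable_modulus bounded_integrable_conv_\<psi>)

lemma energy_split:
  assumes g: "bounded_integrable g"
  shows "energy g = energy (conv g \<phi>) + (\<integral>\<^sup>+l. energy (conv g (\<psi> l)) \<partial>count_space \<Lambda>)"
proof -
  have "(\<integral>\<^sup>+l. spectral_energy (\<lambda>_. 1) (conv g (\<psi> l)) \<partial>count_space \<Lambda>) = (\<integral>\<^sup>+l. energy (conv g (\<psi> l)) \<partial>count_space \<Lambda>)"
    by (intro nn_integral_cong) (simp add: spectral_energy_one bounded_integrable_conv_\<psi>[OF g])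
  then show ?thesis
    using spectral_energy_split[OF g, of "\<lambda>_. 1"]
      spectral_energy_one[OF g] spectral_energy_one[OF bounded_integrable_conv_\<phi>[OF g]] by simp
qed

lemma high_energy_layer:
  assumes g: "bounded_integrable g" and s: "s > 0"
  shows "(\<integral>\<^sup>+l. high_energy s (modulus (conv g (\<psi> l))) \<partial>count_space \<Lambda>) \<le> high_energy s g"
proof -
  have "(\<integral>\<^sup>+l. high_energy s (modulus (conv g (\<psi> l))) \<partial>count_space \<Lambda>)
      \<le> (\<integral>\<^sup>+l. high_energy s (conv g (\<psi> l)) \<partial>count_space \<Lambda>)"
    by (intro nn_integral_mono) (simp add: high_energy_modulus bounded_integrable_conv_\<psi> g s)
  also have "high_energy s g = high_energy s (conv g \<phi>) + (\<integral>\<^sup>+l. high_energy s (conv g (\<psi> l)) \<partial>count_space \<Lambda>)"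
    using s by (intro spectral_energy_split[OF g]) (auto simp: gaussian_le_1)
  then have "(\<integral>\<^sup>+l. high_energy s (conv g (\<psi> l)) \<partial>count_space \<Lambda>) \<le> high_energy s g"
    by simp
  finally show ?thesis .
qed

text \<open>
  Here \<open>low_energy_modulus\<close> is applied to each \<open>g * \<psi> l\<close>, with one constant for all filters, so the
  estimates can be summed over the filters however their frequency bands are placed.
\<close>

lemma low_energy_layer:
  assumes g: "bounded_integrable g" and s: "0 < s'" "s' \<le> s"
  shows "low_energy s' g \<le> energy (conv g \<phi>)
    + ennreal (sqrt (s / s') ^ DIM('a)) * (\<integral>\<^sup>+l. low_energy s (modulus (conv g (\<psi> l))) \<partial>count_space \<Lambda>)"
proof -
  have "(\<integral>\<^sup>+l. low_energy s' (conv g (\<psi> l)) \<partial>count_space \<Lambda>)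
      \<le> (\<integral>\<^sup>+l. ennreal (sqrt (s / s') ^ DIM('a)) * low_energy s (modulus (conv g (\<psi> l))) \<partial>count_space \<Lambda>)"
    by (intro nn_integral_mono) (simp add: low_energy_modulus bounded_integrable_conv_\<psi> g s)
  also have "\<dots> = ennreal (sqrt (s / s') ^ DIM('a)) * (\<integral>\<^sup>+l. low_energy s (modulus (conv g (\<psi> l))) \<partial>count_space \<Lambda>)"
    by (rule nn_integral_cmult) simp
  finally show ?thesis
    using low_energy_le[OF bounded_integrable_conv_\<phi>[OF g], of s'] s
    by (subst spectral_energy_split[OF g]) (auto intro!: add_mono less_imp_le[OF gaussian_pos])
qed

text \<open>
  On a ball of radius \<open>r\<close> about the origin the squared transform of \<open>\<phi>\<close> is bounded below, by continuity,
  so the low-pass output controls the energy there. Outside that ball the weight itself is small.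
\<close>

lemma low_energy_le_low_pass:
  obtains r C :: real where "r > 0"
    "\<And>g s. bounded_integrable g \<Longrightarrow> s \<ge> 0 \<Longrightarrow>
      low_energy s g \<le> ennreal C * energy (conv g \<phi>) + ennreal (exp (- s * r\<^sup>2)) * energy g"
proof -
  \<comment> \<open>Any positive constant below the value at the origin would do.\<close>
  define c where "c = (cmod (fourier \<phi> 0))\<^sup>2 / 2"
  have c: "c > 0" "c < (cmod (fourier \<phi> 0))\<^sup>2" using low_pass by (auto simp: c_def)
  have "isCont (\<lambda>\<xi>. (cmod (fourier \<phi> \<xi>))\<^sup>2) 0"
    using continuous_fourier[OF \<phi>(1)] by (intro continuous_intros)
  then have "\<forall>\<^sub>F \<xi> in at 0. c < (cmod (fourier \<phi> \<xi>))\<^sup>2"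
    unfolding isCont_def using c(2) by (rule order_tendstoD)
  then obtain r where r: "r > 0" "\<And>\<xi>. \<xi> \<noteq> 0 \<Longrightarrow> norm \<xi> < r \<Longrightarrow> c < (cmod (fourier \<phi> \<xi>))\<^sup>2"
    unfolding eventually_at by auto
  have r': "c \<le> (cmod (fourier \<phi> \<xi>))\<^sup>2" if "norm \<xi> < r" for \<xi>
    using r(2)[of \<xi>] c(2) that by (cases "\<xi> = 0") auto
  show thesis
  proof (rule that[OF r(1), of "1 / c"])
    fix g :: "'a \<Rightarrow> complex" and s :: real assume g: "bounded_integrable g" and s: "s \<ge> 0"
    note bounded_integrableD(2)[OF g, measurable]
    have conv: "spectral_energy (\<lambda>_. 1) (conv g \<phi>) = energy (conv g \<phi>)"
      by (rule spectral_energy_one[OF bounded_integrable_conv_\<phi>[OF g]])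
    have "low_energy s g \<le> (\<integral>\<^sup>+\<xi>. ennreal (1 / c) * ennreal ((cmod (fourier (conv g \<phi>) \<xi>))\<^sup>2)
        + ennreal (exp (- s * r\<^sup>2)) * ennreal ((cmod (fourier g \<xi>))\<^sup>2) \<partial>lborel)"
      unfolding spectral_energy_def
    proof (rule nn_integral_mono)
      fix \<xi> :: 'a
      have "gaussian s \<xi> * (cmod (fourier g \<xi>))\<^sup>2
          \<le> 1 / c * (cmod (fourier (conv g \<phi>) \<xi>))\<^sup>2 + exp (- s * r\<^sup>2) * (cmod (fourier g \<xi>))\<^sup>2"
      proof (cases "norm \<xi> < r")
        case True
        have "gaussian s \<xi> * (cmod (fourier g \<xi>))\<^sup>2 \<le> ((cmod (fourier \<phi> \<xi>))\<^sup>2 / c) * (cmod (fourier g \<xi>))\<^sup>2"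
          using r'[OF True] c gaussian_le_1[OF s, of \<xi>]
          by (intro mult_right_mono) (auto intro!: order_trans[OF gaussian_le_1[OF s]])
        also have "\<dots> = 1 / c * (cmod (fourier (conv g \<phi>) \<xi>))\<^sup>2"
          by (simp add: fourier_conv[OF bounded_integrableD(1)[OF g] \<phi>(1)] norm_mult power_mult_distrib)
        finally show ?thesis by (simp add: add_increasing2)
      next
        case False
        then have "gaussian s \<xi> \<le> exp (- s * r\<^sup>2)"
          using s r(1) by (auto simp: gaussian_def intro!: mult_left_mono power_mono)
        then have "gaussian s \<xi> * (cmod (fourier g \<xi>))\<^sup>2 \<le> exp (- s * r\<^sup>2) * (cmod (fourier g \<xi>))\<^sup>2"
          by (intro mult_right_mono) auto
        then show ?thesis using c by (simp add: add_increasing)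
      qed
      then show "ennreal (gaussian s \<xi> * (cmod (fourier g \<xi>))\<^sup>2)
          \<le> ennreal (1 / c) * ennreal ((cmod (fourier (conv g \<phi>) \<xi>))\<^sup>2)
            + ennreal (exp (- s * r\<^sup>2)) * ennreal ((cmod (fourier g \<xi>))\<^sup>2)"
        using c by (simp add: ennreal_mult'[symmetric] ennreal_plus[symmetric] ennreal_leI del: ennreal_plus)
    qed
    also have "\<dots> = ennreal (1 / c) * energy (conv g \<phi>) + ennreal (exp (- s * r\<^sup>2)) * energy g"
      unfolding conv[symmetric] spectral_energy_one[OF g, symmetric] spectral_energy_def mult_1
      using conv_measurable[OF bounded_integrableD(2)[OF g] \<phi>_measurable, measurable]
      by (simp add: nn_integral_add nn_integral_cmult)
    finally show "low_energy s g \<le> ennreal (1 / c) * energy (conv g \<phi>) + ennreal (exp (- s * r\<^sup>2)) * energy g" .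
  qed
qed

end

section \<open>Square integrable functions\<close>

definition square_integrable :: "('a::euclidean_space \<Rightarrow> complex) \<Rightarrow> bool" where
  "square_integrable f \<longleftrightarrow> f \<in> borel_measurable borel \<and> energy f < \<infinity>"

lemma square_integrableD:
  assumes "square_integrable f"
  shows "f \<in> borel_measurable borel" "energy f < \<infinity>"
  using assms by (auto simp: square_integrable_def)

lemma bounded_integrable_imp_square_integrable: "bounded_integrable f \<Longrightarrow> square_integrable f"
  unfolding square_integrable_def using bounded_integrableD(2) energy_finite by blast

lemma square_integrable_modulus:
  assumes "square_integrable f"
  shows "square_integrable (modulus f)"
proof -
  note square_integrableD(1)[OF assms, measurable]
  have "modulus f \<in> borel_measurable borel" by measurable
  then show ?thesis using square_integrableD(2)[OF assms] by (simp add: square_integrable_def)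
qed

text \<open>
  Besides giving closure under subtraction, this identity replaces the triangle inequality of the norm
  in all approximation arguments, so that only squared norms occur.
\<close>

lemma energy_parallelogram:
  assumes [measurable]: "a \<in> borel_measurable borel" "b \<in> borel_measurable borel"
  shows "energy (\<lambda>x. a x + b x) + energy (\<lambda>x. a x - b x) = 2 * energy a + 2 * energy b"
proof -
  have eq: "ennreal ((cmod (u + v))\<^sup>2) + ennreal ((cmod (u - v))\<^sup>2)
      = 2 * ennreal ((cmod u)\<^sup>2) + 2 * ennreal ((cmod v)\<^sup>2)" for u v
  proof -
    have "(cmod (u + v))\<^sup>2 + (cmod (u - v))\<^sup>2 = 2 * (cmod u)\<^sup>2 + 2 * (cmod v)\<^sup>2"
      unfolding cmod_power2 by (simp add: power2_eq_square algebra_simps)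
    then have "ennreal ((cmod (u + v))\<^sup>2 + (cmod (u - v))\<^sup>2) = ennreal (2 * (cmod u)\<^sup>2 + 2 * (cmod v)\<^sup>2)"
      by simp
    then show ?thesis by (simp add: ennreal_mult')
  qed
  have "energy (\<lambda>x. a x + b x) + energy (\<lambda>x. a x - b x)
      = (\<integral>\<^sup>+x. 2 * ennreal ((cmod (a x))\<^sup>2) + 2 * ennreal ((cmod (b x))\<^sup>2) \<partial>lborel)"
    unfolding energy_def by (subst nn_integral_add[symmetric]) (auto simp: eq)
  also have "\<dots> = 2 * energy a + 2 * energy b"
    unfolding energy_def by (subst nn_integral_add) (auto simp: nn_integral_cmult)
  finally show ?thesis .
qed

lemma energy_add_le:
  assumes "a \<in> borel_measurable borel" "b \<in> borel_measurable borel"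
  shows "energy (\<lambda>x. a x + b x) \<le> 2 * energy a + 2 * energy b"
  unfolding energy_parallelogram[OF assms, symmetric] by simp

lemma square_integrable_diff:
  assumes a: "square_integrable a" and b: "square_integrable b"
  shows "square_integrable (\<lambda>x. a x - b x)"
proof -
  note square_integrableD(1)[OF a, measurable] square_integrableD(1)[OF b, measurable]
  have "energy (\<lambda>x. a x + b x) + energy (\<lambda>x. a x - b x) < \<infinity>"
    using square_integrableD(2)[OF a] square_integrableD(2)[OF b]
    by (simp add: energy_parallelogram ennreal_mult_less_top)
  then show ?thesis
    by (auto simp: square_integrable_def)
qed

lemma integrable_conv_integrand:
  assumes f: "square_integrable f" and h: "square_integrable h"
  shows "integrable lborel (\<lambda>y. f y * h (x - y))"
proof -
  note square_integrableD(1)[OF f, measurable] square_integrableD(1)[OF h, measurable]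
  have i: "integrable lborel (\<lambda>y. (cmod (f y))\<^sup>2)" "integrable lborel (\<lambda>y. (cmod (h y))\<^sup>2)"
    using square_integrableD(2)[OF f] square_integrableD(2)[OF h]
    by (auto simp: energy_def integrable_iff_bounded)
  show ?thesis
  proof (rule Bochner_Integration.integrable_bound)
    show "integrable lborel (\<lambda>y. (cmod (f y))\<^sup>2 + (cmod (h (x - y)))\<^sup>2)"
      using i(1) integrable_reflect[OF i(2)] by simp
    have "u * v \<le> u\<^sup>2 + v\<^sup>2" if "u \<ge> 0" "v \<ge> 0" for u v :: real
      using sum_squares_bound[of u v] that mult_nonneg_nonneg[OF that] by linarith
    then show "AE y in lborel. norm (f y * h (x - y)) \<le> norm ((cmod (f y))\<^sup>2 + (cmod (h (x - y)))\<^sup>2)"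
      by (intro AE_I2) (simp add: norm_mult)
  qed measurable
qed

lemma
  assumes a: "square_integrable a" and b: "square_integrable b" and h: "square_integrable h"
  shows conv_add: "conv (\<lambda>x. a x + b x) h = (\<lambda>x. conv a h x + conv b h x)"
    and conv_diff: "conv (\<lambda>x. a x - b x) h = (\<lambda>x. conv a h x - conv b h x)"
proof -
  note m = square_integrableD(1)[OF a] square_integrableD(1)[OF b] square_integrableD(1)[OF h]
  note m[measurable]
  have s: "(\<lambda>x. a x + b x) \<in> borel_measurable borel" "(\<lambda>x. a x - b x) \<in> borel_measurable borel"
    by measurable
  show "conv (\<lambda>x. a x + b x) h = (\<lambda>x. conv a h x + conv b h x)"
    by (rule ext) (simp add: conv_lborel m s distrib_right integrable_conv_integrand[OF a h] integrable_conv_integrand[OF b h])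
  show "conv (\<lambda>x. a x - b x) h = (\<lambda>x. conv a h x - conv b h x)"
    by (rule ext) (simp add: conv_lborel m s left_diff_distrib integrable_conv_integrand[OF a h] integrable_conv_integrand[OF b h])
qed

text \<open>
  Cutting off both the domain and the values produces a bounded integrable function.
\<close>

definition truncate :: "nat \<Rightarrow> ('a::euclidean_space \<Rightarrow> complex) \<Rightarrow> 'a \<Rightarrow> complex" where
  "truncate n f x = (if norm x \<le> real n \<and> cmod (f x) \<le> real n then f x else 0)"

lemma norm_truncate_le: "cmod (truncate n f x) \<le> cmod (f x)"
  by (simp add: truncate_def)

lemma truncate_measurable [measurable]:
  assumes [measurable]: "f \<in> borel_measurable borel"
  shows "truncate n f \<in> borel_measurable borel"
  unfolding truncate_def[abs_def] by measurable

lemma truncate_eventually: "\<forall>\<^sub>F n in sequentially. truncate n f x = f x"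
proof -
  obtain N where N: "max (norm x) (cmod (f x)) \<le> real N" using real_arch_simple by blast
  show ?thesis
    using eventually_ge_at_top[of N]
  proof eventually_elim
    case (elim n)
    then have "real N \<le> real n" by simp
    with N show ?case by (simp add: truncate_def)
  qed
qed

lemma bounded_integrable_truncate:
  fixes f :: "'a::euclidean_space \<Rightarrow> complex"
  assumes [measurable]: "f \<in> borel_measurable borel"
  shows "bounded_integrable (truncate n f)"
proof -
  have "integrable lborel (truncate n f)"
  proof (rule Bochner_Integration.integrable_bound)
    show "integrable lborel (\<lambda>x. real n * indicator (cball (0::'a) (real n)) x)"
      by (intro integrable_mult_right integrable_real_indicator emeasure_bounded_finite bounded_cball) simp
    show "AE x in lborel. norm (truncate n f x) \<le> norm (real n * indicator (cball (0::'a) (real n)) x)"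
      by (auto simp: truncate_def indicator_def)
  qed measurable
  moreover have "cmod (truncate n f x) \<le> real n" for x
    by (simp add: truncate_def)
  ultimately show ?thesis by (auto simp: bounded_integrable_def)
qed

lemma square_integrable_truncate: "square_integrable f \<Longrightarrow> square_integrable (truncate n f)"
  by (rule bounded_integrable_imp_square_integrable[OF bounded_integrable_truncate[OF square_integrableD(1)]])

lemma energy_truncate_le: "energy (truncate n f) \<le> energy f"
  unfolding energy_def
  by (intro nn_integral_mono ennreal_leI power_mono norm_truncate_le) auto

lemma energy_truncate_error:
  assumes f: "square_integrable f"
  shows "(\<lambda>n. energy (\<lambda>x. f x - truncate n f x)) \<longlonglongrightarrow> 0"
proof -
  note square_integrableD(1)[OF f, measurable]
  have "(\<lambda>n. energy (\<lambda>x. f x - truncate n f x)) \<longlonglongrightarrow> (\<integral>\<^sup>+(x::'a). 0 \<partial>lborel)"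
    unfolding energy_def
  proof (rule nn_integral_dominated_convergence[where w="\<lambda>x. ennreal ((cmod (f x))\<^sup>2)"])
    show "AE x in lborel. ennreal ((cmod (f x - truncate n f x))\<^sup>2) \<le> ennreal ((cmod (f x))\<^sup>2)" for n
      by (intro AE_I2 ennreal_leI power_mono) (auto simp: truncate_def)
    show "(\<integral>\<^sup>+x. ennreal ((cmod (f x))\<^sup>2) \<partial>lborel) < \<infinity>"
      using square_integrableD(2)[OF f] by (simp add: energy_def)
    show "AE x in lborel. (\<lambda>n. ennreal ((cmod (f x - truncate n f x))\<^sup>2)) \<longlonglongrightarrow> 0"
    proof (intro AE_I2 tendsto_eventually)
      show "\<forall>\<^sub>F n in sequentially. ennreal ((cmod (f x - truncate n f x))\<^sup>2) = 0" for x
        using truncate_eventually[of f x] by eventually_elim simp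
    qed
  qed measurable
  then show ?thesis by simp
qed

lemma conv_truncate_tendsto:
  assumes f: "square_integrable f" and h: "square_integrable h"
  shows "(\<lambda>n. conv (truncate n f) h x) \<longlonglongrightarrow> conv f h x"
proof -
  note m = square_integrableD(1)[OF f] square_integrableD(1)[OF h]
  note m[measurable]
  have "(\<lambda>n. LINT y|lborel. truncate n f y * h (x - y)) \<longlonglongrightarrow> (LINT y|lborel. f y * h (x - y))"
  proof (rule integral_dominated_convergence[where w="\<lambda>y. cmod (f y * h (x - y))"])
    show "integrable lborel (\<lambda>y. cmod (f y * h (x - y)))"
      by (rule integrable_norm[OF integrable_conv_integrand[OF f h]])
    show "AE y in lborel. (\<lambda>n. truncate n f y * h (x - y)) \<longlonglongrightarrow> f y * h (x - y)"
    proof (intro AE_I2 tendsto_eventually)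
      show "\<forall>\<^sub>F n in sequentially. truncate n f y * h (x - y) = f y * h (x - y)" for y
        using truncate_eventually[of f y] by eventually_elim simp
    qed
    show "AE y in lborel. norm (truncate n f y * h (x - y)) \<le> cmod (f y * h (x - y))" for n
      by (intro AE_I2) (auto simp: norm_mult intro!: mult_right_mono norm_truncate_le)
  qed measurable
  then show ?thesis by (simp add: conv_lborel m)
qed

lemma energy_conv_le_liminf:
  assumes f: "square_integrable f" and h: "square_integrable h"
  shows "energy (conv f h) \<le> liminf (\<lambda>n. energy (conv (truncate n f) h))"
proof -
  note m = square_integrableD(1)[OF f] square_integrableD(1)[OF h]
  note m[measurable] and conv_measurable[OF truncate_measurable[OF m(1)] m(2), measurable]
  have "energy (conv f h) = (\<integral>\<^sup>+x. liminf (\<lambda>n. ennreal ((cmod (conv (truncate n f) h x))\<^sup>2)) \<partial>lborel)"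
    unfolding energy_def
    by (intro nn_integral_cong lim_imp_Liminf[symmetric] tendsto_ennrealI tendsto_power tendsto_norm
        conv_truncate_tendsto f h) simp
  also have "\<dots> \<le> liminf (\<lambda>n. energy (conv (truncate n f) h))"
    unfolding energy_def by (rule nn_integral_liminf) measurable
  finally show ?thesis .
qed

context borel_filter_bank
begin

lemma \<phi>_square_integrable: "square_integrable \<phi>"
  using \<phi> by (simp add: square_integrable_def)

lemma \<psi>_square_integrable: "l \<in> \<Lambda> \<Longrightarrow> square_integrable (\<psi> l)"
  using \<psi> \<psi>_measurable by (simp add: square_integrable_def)

text \<open>
  The moduli of the cascade are omitted: they do not change energies, and without them the expression
  is a quadratic form in \<open>g\<close>.
\<close>

definition one_step_energy :: "('a \<Rightarrow> complex) \<Rightarrow> ennreal" where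
  "one_step_energy g = energy (conv g \<phi>) + (\<integral>\<^sup>+l. energy (conv g (\<psi> l)) \<partial>count_space \<Lambda>)"

text \<open>
  Fatou's lemma, applied to the truncations of \<open>g\<close>, for which equality is known. The two summands are
  treated separately, with lower limits written as suprema of increasing sequences.
\<close>

lemma one_step_energy_le:
  assumes g: "square_integrable g"
  shows "one_step_energy g \<le> energy g"
proof -
  let ?A = "\<lambda>n. energy (conv (truncate n g) \<phi>)"
  let ?B = "\<lambda>n. \<integral>\<^sup>+l. energy (conv (truncate n g) (\<psi> l)) \<partial>count_space \<Lambda>"
  have AB: "?A n + ?B n \<le> energy g" for n
    using energy_split[OF bounded_integrable_truncate[OF square_integrableD(1)[OF g]]] energy_truncate_le[of n g]
    by simp
  have "(\<integral>\<^sup>+l. energy (conv g (\<psi> l)) \<partial>count_space \<Lambda>)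
      \<le> (\<integral>\<^sup>+l. liminf (\<lambda>n. energy (conv (truncate n g) (\<psi> l))) \<partial>count_space \<Lambda>)"
    by (intro nn_integral_mono energy_conv_le_liminf g \<psi>_square_integrable) simp
  also have "\<dots> \<le> liminf ?B"
    by (rule nn_integral_liminf) simp
  finally have "one_step_energy g \<le> liminf ?A + liminf ?B"
    unfolding one_step_energy_def by (intro add_mono energy_conv_le_liminf g \<phi>_square_integrable)
  also have "\<dots> = (SUP n. (INF m\<in>{n..}. ?A m) + (INF m\<in>{n..}. ?B m))"
    unfolding liminf_SUP_INF
    by (rule ennreal_SUP_add[symmetric]) (auto simp: incseq_def intro!: INF_superset_mono)
  also have "\<dots> \<le> energy g"
    by (intro SUP_least order_trans[OF add_mono AB] INF_lower) auto
  finally show ?thesis .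
qed

lemma square_integrable_conv_\<psi>:
  assumes g: "square_integrable g" and l: "l \<in> \<Lambda>"
  shows "square_integrable (conv g (\<psi> l))"
proof -
  have "energy (conv g (\<psi> l)) \<le> (\<integral>\<^sup>+k. energy (conv g (\<psi> k)) \<partial>count_space \<Lambda>)"
    by (rule nn_integral_ge_point[OF l])
  also have "\<dots> \<le> energy g"
    using one_step_energy_le[OF g] by (simp add: one_step_energy_def order_trans[rotated])
  also have "\<dots> < \<infinity>" by (rule square_integrableD[OF g])
  finally show ?thesis
    using conv_measurable[OF square_integrableD(1)[OF g] \<psi>_measurable[OF l]]
    by (simp add: square_integrable_def)
qed

lemma conv_\<phi>_measurable: "square_integrable g \<Longrightarrow> conv g \<phi> \<in> borel_measurable borel"
  by (intro conv_measurable square_integrableD \<phi>_measurable)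

lemma conv_\<psi>_measurable: "square_integrable g \<Longrightarrow> l \<in> \<Lambda> \<Longrightarrow> conv g (\<psi> l) \<in> borel_measurable borel"
  by (intro conv_measurable square_integrableD \<psi>_measurable)

lemma one_step_energy_parallelogram:
  assumes a: "square_integrable a" and b: "square_integrable b"
  shows "one_step_energy (\<lambda>x. a x + b x) + one_step_energy (\<lambda>x. a x - b x) = 2 * one_step_energy a + 2 * one_step_energy b"
proof -
  have 1: "energy (conv (\<lambda>x. a x + b x) \<phi>) + energy (conv (\<lambda>x. a x - b x) \<phi>) = 2 * energy (conv a \<phi>) + 2 * energy (conv b \<phi>)"
    unfolding conv_add[OF a b \<phi>_square_integrable] conv_diff[OF a b \<phi>_square_integrable]
    by (intro energy_parallelogram conv_\<phi>_measurable a b)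
  have "(\<integral>\<^sup>+l. energy (conv (\<lambda>x. a x + b x) (\<psi> l)) \<partial>count_space \<Lambda>)
      + (\<integral>\<^sup>+l. energy (conv (\<lambda>x. a x - b x) (\<psi> l)) \<partial>count_space \<Lambda>)
    = (\<integral>\<^sup>+l. energy (conv (\<lambda>x. a x + b x) (\<psi> l)) + energy (conv (\<lambda>x. a x - b x) (\<psi> l)) \<partial>count_space \<Lambda>)"
    by (rule nn_integral_add[symmetric]) auto
  also have "\<dots> = (\<integral>\<^sup>+l. 2 * energy (conv a (\<psi> l)) + 2 * energy (conv b (\<psi> l)) \<partial>count_space \<Lambda>)"
  proof (rule nn_integral_cong)
    fix l assume "l \<in> space (count_space \<Lambda>)"
    then have l: "l \<in> \<Lambda>" by simp
    show "energy (conv (\<lambda>x. a x + b x) (\<psi> l)) + energy (conv (\<lambda>x. a x - b x) (\<psi> l)) = 2 * energy (conv a (\<psi> l)) + 2 * energy (conv b (\<psi> l))"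
      unfolding conv_add[OF a b \<psi>_square_integrable[OF l]] conv_diff[OF a b \<psi>_square_integrable[OF l]]
      by (intro energy_parallelogram conv_\<psi>_measurable a b l)
  qed
  also have "\<dots> = 2 * (\<integral>\<^sup>+l. energy (conv a (\<psi> l)) \<partial>count_space \<Lambda>) + 2 * (\<integral>\<^sup>+l. energy (conv b (\<psi> l)) \<partial>count_space \<Lambda>)"
    by (simp add: nn_integral_add nn_integral_cmult)
  finally have 2: "(\<integral>\<^sup>+l. energy (conv (\<lambda>x. a x + b x) (\<psi> l)) \<partial>count_space \<Lambda>)
      + (\<integral>\<^sup>+l. energy (conv (\<lambda>x. a x - b x) (\<psi> l)) \<partial>count_space \<Lambda>)
    = 2 * (\<integral>\<^sup>+l. energy (conv a (\<psi> l)) \<partial>count_space \<Lambda>) + 2 * (\<integral>\<^sup>+l. energy (conv b (\<psi> l)) \<partial>count_space \<Lambda>)" .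
  have swap: "(u + v) + (x + y) = (u + x) + (v + y)" for u v x y :: ennreal
    by (simp only: ac_simps)
  show ?thesis
    unfolding one_step_energy_def distrib_left swap 1 2 ..
qed

text \<open>
  Both sides obey the parallelogram law and agree on truncations. Write \<open>g = t + d\<close> with a truncation
  \<open>t\<close> and a small remainder \<open>d\<close>: the law for \<open>t\<close> and \<open>d\<close>, together with the inequality already known,
  applied to \<open>t - d\<close>, bounds the possible defect of \<open>g\<close> by twice the energy of \<open>d\<close>.
\<close>

theorem one_step_energy_eq:
  assumes g: "square_integrable g"
  shows "one_step_energy g = energy g"
proof (rule antisym[OF one_step_energy_le[OF g]])
  define t where "t n = truncate n g" for n
  define d where "d n = (\<lambda>x. g x - t n x)" for n
  \<comment> \<open>The reflection of \<open>g = t + d\<close> at the truncation \<open>t\<close>.\<close>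
  define e where "e n = (\<lambda>x. t n x - d n x)" for n
  have t: "square_integrable (t n)" and d: "square_integrable (d n)" for n
    unfolding d_def t_def by (intro square_integrable_diff square_integrable_truncate g)+
  have e: "square_integrable (e n)" for n
    unfolding e_def by (intro square_integrable_diff t d)
  have g_eq: "g = (\<lambda>x. t n x + d n x)" for n by (simp add: d_def)
  have le: "energy g \<le> one_step_energy g + 2 * energy (d n)" for n
  proof -
    have "energy g + energy (e n) = 2 * energy (t n) + 2 * energy (d n)"
      unfolding e_def by (subst g_eq[of n]) (intro energy_parallelogram square_integrableD t d)
    moreover have "energy (t n) = one_step_energy (t n)"
      unfolding one_step_energy_def t_def
      by (rule energy_split[OF bounded_integrable_truncate[OF square_integrableD(1)[OF g]]])
    moreover have "2 * one_step_energy (t n) \<le> one_step_energy g + energy (e n)"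
    proof -
      have "2 * one_step_energy (t n) + 2 * one_step_energy (d n) = one_step_energy g + one_step_energy (e n)"
        using one_step_energy_parallelogram[OF t d, of n n] unfolding e_def g_eq[of n, symmetric] by simp
      then have "2 * one_step_energy (t n) \<le> one_step_energy g + one_step_energy (e n)"
        by (metis le_iff_add)
      also have "\<dots> \<le> one_step_energy g + energy (e n)"
        by (intro add_left_mono one_step_energy_le e)
      finally show ?thesis .
    qed
    ultimately have "energy g + energy (e n) \<le> (one_step_energy g + energy (e n)) + 2 * energy (d n)"
      by (metis add_right_mono)
    then have "energy (e n) + energy g \<le> energy (e n) + (one_step_energy g + 2 * energy (d n))"
      by (simp only: ac_simps)
    then show ?thesis
      using square_integrableD(2)[OF e[of n]] by (auto simp: ennreal_add_left_cancel_le)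
  qed
  have "(\<lambda>n. one_step_energy g + 2 * energy (d n)) \<longlonglongrightarrow> one_step_energy g + 2 * 0"
    unfolding d_def t_def
    by (intro tendsto_add tendsto_const ennreal_tendsto_cmult energy_truncate_error g) simp
  then show "energy g \<le> one_step_energy g"
    using le by (intro LIMSEQ_le_const[of _ "one_step_energy g"]) auto
qed

end

section \<open>The energy of a layer tends to zero\<close>

lemma gaussian_beats_power:
  assumes r: "r > (0::real)" and s: "s > 0"
  shows "(\<lambda>n. sqrt (real n / s) ^ d * exp (- real n * r\<^sup>2)) \<longlonglongrightarrow> 0"
proof (rule tendsto_sandwich[OF _ _ tendsto_const])
  have "filterlim (\<lambda>n. r\<^sup>2 * real n) at_top sequentially"
    using r by (intro filterlim_tendsto_pos_mult_at_top[OF tendsto_const] filterlim_real_sequentially) simp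
  from filterlim_compose[OF tendsto_power_div_exp_0 this]
  have "(\<lambda>n. (r\<^sup>2 * real n) ^ d / exp (r\<^sup>2 * real n)) \<longlonglongrightarrow> 0" .
  then show "(\<lambda>n. (1 / (s * r\<^sup>2)) ^ d * ((r\<^sup>2 * real n) ^ d / exp (r\<^sup>2 * real n))) \<longlonglongrightarrow> 0"
    by (rule tendsto_mult_right_zero)
  obtain k where k: "s \<le> real k" using real_arch_simple by blast
  show "\<forall>\<^sub>F n in sequentially. sqrt (real n / s) ^ d * exp (- real n * r\<^sup>2)
      \<le> (1 / (s * r\<^sup>2)) ^ d * ((r\<^sup>2 * real n) ^ d / exp (r\<^sup>2 * real n))"
    using eventually_ge_at_top[of k]
  proof eventually_elim
    case (elim n)
    have x: "real n / s \<ge> 1" using s k elim by simp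
    then have "sqrt (real n / s) \<le> real n / s"
      using power2_le_imp_le[of "sqrt (real n / s)" "real n / s"] by (simp add: self_le_power)
    then have "sqrt (real n / s) ^ d * exp (- real n * r\<^sup>2) \<le> (real n / s) ^ d * exp (- real n * r\<^sup>2)"
      using s by (intro mult_right_mono power_mono) auto
    also have "(real n / s) ^ d = (1 / (s * r\<^sup>2)) ^ d * (r\<^sup>2 * real n) ^ d"
      using r by (simp flip: power_mult_distrib)
    finally show ?case by (simp add: exp_minus field_simps)
  qed
qed (use s in \<open>auto intro!: always_eventually\<close>)

context borel_filter_bank
begin

text \<open>
  The functional \<open>F\<close> will be the energy, its low or high part, or the energy of the low-pass output; an
  estimate for a single node then sums up to one for the layer.
\<close>

definition layer :: "(('a \<Rightarrow> complex) \<Rightarrow> ennreal) \<Rightarrow> nat \<Rightarrow> ('a \<Rightarrow> complex) \<Rightarrow> ennreal" where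
  "layer F N f = (\<integral>\<^sup>+p. F (scat_U \<psi> p f) \<partial>count_space (paths_of_length \<Lambda> N))"

lemma layer_0: "layer F 0 f = F f"
  by (simp add: layer_def sum_paths_0)

lemma layer_Suc: "layer F (Suc N) f = layer (\<lambda>g. \<integral>\<^sup>+l. F (modulus (conv g (\<psi> l))) \<partial>count_space \<Lambda>) N f"
  by (simp add: layer_def sum_paths_Suc[OF countable] scat_U_snoc scat_U1_def)

lemma layer_add: "layer (\<lambda>g. F g + G g) N f = layer F N f + layer G N f"
  unfolding layer_def by (rule nn_integral_add) auto

lemma layer_cmult: "layer (\<lambda>g. c * F g) N f = c * layer F N f"
  unfolding layer_def by (rule nn_integral_cmult) auto

lemma layer_mono:
  assumes "bounded_integrable f" "\<And>g. bounded_integrable g \<Longrightarrow> F g \<le> G g"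
  shows "layer F N f \<le> layer G N f"
  unfolding layer_def using assms
  by (intro nn_integral_mono) (auto simp: paths_of_length_def intro!: bounded_integrable_scat_U)

lemma square_integrable_scat_U:
  assumes "square_integrable f" "set p \<subseteq> \<Lambda>"
  shows "square_integrable (scat_U \<psi> p f)"
  using assms
  by (induction p arbitrary: f)
    (auto simp: scat_U1_def intro!: square_integrable_modulus square_integrable_conv_\<psi>)

lemma layer_energy_split:
  assumes f: "square_integrable f"
  shows "layer energy N f = layer (\<lambda>g. energy (conv g \<phi>)) N f + layer energy (Suc N) f"
proof -
  have "layer energy N f = layer one_step_energy N f"
    unfolding layer_def using f
    by (intro nn_integral_cong)
      (auto simp: paths_of_length_def intro!: one_step_energy_eq[symmetric] square_integrable_scat_U)
  also have "\<dots> = layer (\<lambda>g. energy (conv g \<phi>)) N f + layer energy (Suc N) f"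
    unfolding layer_Suc energy_modulus one_step_energy_def layer_add ..
  finally show ?thesis .
qed

lemma layer_energy_Suc_le: "square_integrable f \<Longrightarrow> layer energy (Suc N) f \<le> layer energy N f"
  by (subst layer_energy_split[of f N]) auto

lemma layer_energy_le: "square_integrable f \<Longrightarrow> layer energy N f \<le> energy f"
proof (induction N)
  case (Suc N)
  then show ?case using layer_energy_Suc_le[of f N] by (auto intro: order_trans)
qed (simp add: layer_0)

lemma layer_energy_convergent:
  assumes f: "square_integrable f"
  obtains W where "(\<lambda>N. layer energy N f) \<longlonglongrightarrow> W" "W < \<infinity>"
proof
  have "decseq (\<lambda>N. layer energy N f)"
    using layer_energy_Suc_le[OF f] by (rule decseq_SucI)
  then show "(\<lambda>N. layer energy N f) \<longlonglongrightarrow> (INF N. layer energy N f)"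
    by (rule LIMSEQ_INF)
  have "(INF N. layer energy N f) \<le> energy f"
    using layer_energy_le[OF f] by (intro INF_lower2[of 0]) auto
  then show "(INF N. layer energy N f) < \<infinity>"
    using square_integrableD(2)[OF f] by (rule le_less_trans)
qed

text \<open>
  The low-pass energies are the differences of consecutive terms of the convergent sequence of
  layer energies.
\<close>

lemma low_pass_layer_tendsto_0:
  assumes f: "square_integrable f"
  shows "(\<lambda>N. layer (\<lambda>g. energy (conv g \<phi>)) N f) \<longlonglongrightarrow> 0"
proof -
  obtain W where W: "(\<lambda>N. layer energy N f) \<longlonglongrightarrow> W" "W < \<infinity>"
    by (rule layer_energy_convergent[OF f])
  have fin: "layer energy N f \<noteq> top" for N
    using le_less_trans[OF layer_energy_le[OF f] square_integrableD(2)[OF f], of N] by simp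
  have "(\<lambda>N. layer energy N f - layer energy (Suc N) f) \<longlonglongrightarrow> W - W"
    using W by (intro tendsto_diff_ennreal LIMSEQ_Suc) auto
  moreover have "layer energy N f - layer energy (Suc N) f = layer (\<lambda>g. energy (conv g \<phi>)) N f" for N
    by (subst layer_energy_split[OF f, of N]) (use fin in simp)
  ultimately show ?thesis using W(2) by simp
qed

lemma high_energy_layers_le:
  assumes f: "bounded_integrable f" and s: "s > 0"
  shows "layer (high_energy s) N f \<le> high_energy s f"
proof (induction N)
  case (Suc N)
  have "layer (high_energy s) (Suc N) f \<le> layer (high_energy s) N f"
    unfolding layer_Suc by (intro layer_mono f high_energy_layer s)
  with Suc show ?case by simp
qed (simp add: layer_0)

text \<open>
  The basic estimate. The energy of layer \<open>N\<close> is split at the scale \<open>s'\<close>. The high part is at most that of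
  the input. The low part is passed to the next layer at the larger parameter \<open>s\<close> and is estimated
  there by the low-pass output.
\<close>

lemma layer_energy_le_high_plus_low:
  assumes f: "bounded_integrable f" and s: "0 < s'" "s' \<le> s" and C: "\<And>g s. bounded_integrable g \<Longrightarrow> s \<ge> 0 \<Longrightarrow>
      low_energy s g \<le> ennreal C * energy (conv g \<phi>) + ennreal (exp (- s * r\<^sup>2)) * energy g"
  shows "layer energy N f \<le> high_energy s' f + (layer (\<lambda>g. energy (conv g \<phi>)) N f
    + ennreal (sqrt (s / s') ^ DIM('a)) * (ennreal C * layer (\<lambda>g. energy (conv g \<phi>)) (Suc N) f
      + ennreal (exp (- s * r\<^sup>2)) * energy f))"
proof -
  let ?S = "layer (\<lambda>g. energy (conv g \<phi>))" and ?M = "ennreal (sqrt (s / s') ^ DIM('a))"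
  have "layer energy N f = layer (\<lambda>g. high_energy s' g + low_energy s' g) N f"
    unfolding layer_def using f s
    by (intro nn_integral_cong, subst add.commute)
      (auto simp: paths_of_length_def intro!: low_plus_high[symmetric] bounded_integrable_scat_U)
  also have "\<dots> = layer (high_energy s') N f + layer (low_energy s') N f"
    by (rule layer_add)
  also have "\<dots> \<le> high_energy s' f + (?S N f + ?M * layer (low_energy s) (Suc N) f)"
  proof (rule add_mono[OF high_energy_layers_le[OF f s(1)]])
    have "layer (low_energy s') N f \<le> layer (\<lambda>g. energy (conv g \<phi>)
      + ?M * (\<integral>\<^sup>+l. low_energy s (modulus (conv g (\<psi> l))) \<partial>count_space \<Lambda>)) N f"
      by (intro layer_mono f low_energy_layer s)
    then show "layer (low_energy s') N f \<le> ?S N f + ?M * layer (low_energy s) (Suc N) f"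
      by (simp add: layer_Suc layer_add layer_cmult)
  qed
  also have "layer (low_energy s) (Suc N) f \<le> ennreal C * ?S (Suc N) f + ennreal (exp (- s * r\<^sup>2)) * layer energy (Suc N) f"
    unfolding layer_cmult[symmetric] layer_add[symmetric] using s by (intro layer_mono f C) auto
  also have "layer energy (Suc N) f \<le> energy f"
    by (intro layer_energy_le bounded_integrable_imp_square_integrable f)
  finally show ?thesis by (simp add: add_left_mono mult_left_mono)
qed

text \<open>
  The three parameters of the preceding estimate are sent to their limits one after another: first
  the depth \<open>N\<close> tends to infinity, which removes the low-pass terms, then \<open>s\<close> to infinity, then \<open>s'\<close>
  to zero.
\<close>

lemma layer_energy_tendsto_0_bounded:
  assumes f: "bounded_integrable f"
  shows "(\<lambda>N. layer energy N f) \<longlonglongrightarrow> 0"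
proof -
  let ?S = "layer (\<lambda>g. energy (conv g \<phi>))"
  note fs = bounded_integrable_imp_square_integrable[OF f]
  obtain W where W: "(\<lambda>N. layer energy N f) \<longlonglongrightarrow> W" by (rule layer_energy_convergent[OF fs])
  note S = low_pass_layer_tendsto_0[OF fs]
  obtain r C where r: "r > 0" and C: "\<And>g s. bounded_integrable g \<Longrightarrow> s \<ge> 0 \<Longrightarrow>
      low_energy s g \<le> ennreal C * energy (conv g \<phi>) + ennreal (exp (- s * r\<^sup>2)) * energy g"
    by (rule low_energy_le_low_pass) blast
  have 1: "W \<le> high_energy s' f + ennreal (sqrt (s / s') ^ DIM('a) * exp (- s * r\<^sup>2)) * energy f"
    if s: "0 < s'" "s' \<le> s" for s s'
  proof -
    let ?M = "ennreal (sqrt (s / s') ^ DIM('a))" and ?q = "ennreal (exp (- s * r\<^sup>2))"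
    have "(\<lambda>N. high_energy s' f + (?S N f + ?M * (ennreal C * ?S (Suc N) f + ?q * energy f)))
      \<longlonglongrightarrow> high_energy s' f + (0 + ?M * (ennreal C * 0 + ?q * energy f))"
      by (intro tendsto_add tendsto_const ennreal_tendsto_cmult S LIMSEQ_Suc[OF S]) auto
    then have "W \<le> high_energy s' f + (0 + ?M * (ennreal C * 0 + ?q * energy f))"
      using layer_energy_le_high_plus_low[OF f s C] by (intro LIMSEQ_le[OF W]) auto
    then show ?thesis
      using s by (simp add: ennreal_mult' mult.assoc)
  qed
  have 2: "W \<le> high_energy s' f" if s: "0 < s'" for s'
  proof -
    have "(\<lambda>n. ennreal (sqrt (real n / s') ^ DIM('a) * exp (- real n * r\<^sup>2)) * energy f) \<longlonglongrightarrow> 0"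
      using ennreal_tendsto_cmult[OF _ tendsto_ennrealI[OF gaussian_beats_power[OF r s]], of "energy f" "DIM('a)"]
        energy_finite[OF f] by (simp add: mult.commute)
    then have "(\<lambda>n. high_energy s' f + ennreal (sqrt (real n / s') ^ DIM('a) * exp (- real n * r\<^sup>2)) * energy f)
        \<longlonglongrightarrow> high_energy s' f + 0"
      by (intro tendsto_add tendsto_const)
    moreover have "\<exists>k. \<forall>n\<ge>k. W \<le> high_energy s' f + ennreal (sqrt (real n / s') ^ DIM('a) * exp (- real n * r\<^sup>2)) * energy f"
    proof -
      obtain k where k: "s' \<le> real k" using real_arch_simple by blast
      have "W \<le> high_energy s' f + ennreal (sqrt (real n / s') ^ DIM('a) * exp (- real n * r\<^sup>2)) * energy f" if "n \<ge> k" for n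
        using k that by (intro 1 s) linarith
      then show ?thesis by blast
    qed
    ultimately show ?thesis using LIMSEQ_le_const by fastforce
  qed
  have "W \<le> 0"
    using 2 by (intro LIMSEQ_le_const[OF high_energy_tendsto_0[OF f]]) auto
  with W show ?thesis by simp
qed

text \<open>
  Convolution is linear and does not increase energy, and the modulus is 1-Lipschitz.
\<close>

lemma layer_nonexpansive:
  assumes f: "square_integrable f" and g: "square_integrable g"
  shows "(\<integral>\<^sup>+p. energy (\<lambda>x. scat_U \<psi> p f x - scat_U \<psi> p g x) \<partial>count_space (paths_of_length \<Lambda> N))
    \<le> energy (\<lambda>x. f x - g x)"
proof (induction N)
  case 0
  show ?case by (simp add: sum_paths_0)
next
  case (Suc N)
  have step: "(\<integral>\<^sup>+l. energy (\<lambda>x. modulus (conv a (\<psi> l)) x - modulus (conv b (\<psi> l)) x) \<partial>count_space \<Lambda>)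
      \<le> energy (\<lambda>x. a x - b x)" if a: "square_integrable a" and b: "square_integrable b" for a b
  proof -
    have "(\<integral>\<^sup>+l. energy (\<lambda>x. modulus (conv a (\<psi> l)) x - modulus (conv b (\<psi> l)) x) \<partial>count_space \<Lambda>)
        \<le> (\<integral>\<^sup>+l. energy (conv (\<lambda>x. a x - b x) (\<psi> l)) \<partial>count_space \<Lambda>)"
    proof (rule nn_integral_mono)
      fix l assume "l \<in> space (count_space \<Lambda>)"
      then have l: "l \<in> \<Lambda>" by simp
      have "cmod (modulus u x - modulus v x) \<le> cmod (u x - v x)" for u v :: "'a \<Rightarrow> complex" and x
        unfolding of_real_diff[symmetric] norm_of_real by (rule norm_triangle_ineq3)
      then show "energy (\<lambda>x. modulus (conv a (\<psi> l)) x - modulus (conv b (\<psi> l)) x) \<le> energy (conv (\<lambda>x. a x - b x) (\<psi> l))"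
        unfolding energy_def conv_diff[OF a b \<psi>_square_integrable[OF l]]
        by (intro nn_integral_mono ennreal_leI power_mono) auto
    qed
    also have "\<dots> \<le> one_step_energy (\<lambda>x. a x - b x)"
      by (simp add: one_step_energy_def)
    also have "\<dots> \<le> energy (\<lambda>x. a x - b x)"
      by (intro one_step_energy_le square_integrable_diff a b)
    finally show ?thesis .
  qed
  have "(\<integral>\<^sup>+p. energy (\<lambda>x. scat_U \<psi> p f x - scat_U \<psi> p g x) \<partial>count_space (paths_of_length \<Lambda> (Suc N)))
      \<le> (\<integral>\<^sup>+p. energy (\<lambda>x. scat_U \<psi> p f x - scat_U \<psi> p g x) \<partial>count_space (paths_of_length \<Lambda> N))"
    unfolding sum_paths_Suc[OF countable] scat_U_snoc scat_U1_def
    by (intro nn_integral_mono step square_integrable_scat_U f g) (auto simp: paths_of_length_def)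
  with Suc show ?case by (rule order_trans[rotated])
qed

theorem layer_energy_tendsto_0:
  assumes f: "square_integrable f"
  shows "(\<lambda>N. layer energy N f) \<longlonglongrightarrow> 0"
proof -
  obtain W where W: "(\<lambda>N. layer energy N f) \<longlonglongrightarrow> W" by (rule layer_energy_convergent[OF f])
  have le: "W \<le> 2 * energy (\<lambda>x. f x - truncate n f x)" for n
  proof -
    let ?t = "truncate n f"
    have t: "bounded_integrable ?t" by (intro bounded_integrable_truncate square_integrableD f)
    have ts: "square_integrable ?t" by (rule bounded_integrable_imp_square_integrable[OF t])
    have "layer energy N f \<le> 2 * layer energy N ?t + 2 * energy (\<lambda>x. f x - ?t x)" for N
    proof -
      have "layer energy N f \<le> (\<integral>\<^sup>+p. 2 * energy (scat_U \<psi> p ?t)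
          + 2 * energy (\<lambda>x. scat_U \<psi> p f x - scat_U \<psi> p ?t x) \<partial>count_space (paths_of_length \<Lambda> N))"
        unfolding layer_def
      proof (rule nn_integral_mono)
        fix p assume "p \<in> space (count_space (paths_of_length \<Lambda> N))"
        then have p: "set p \<subseteq> \<Lambda>" by (simp add: paths_of_length_def)
        have "energy (\<lambda>x. scat_U \<psi> p ?t x + (scat_U \<psi> p f x - scat_U \<psi> p ?t x))
            \<le> 2 * energy (scat_U \<psi> p ?t) + 2 * energy (\<lambda>x. scat_U \<psi> p f x - scat_U \<psi> p ?t x)"
          by (intro energy_add_le square_integrableD square_integrable_diff square_integrable_scat_U f ts p)
        then show "energy (scat_U \<psi> p f)
            \<le> 2 * energy (scat_U \<psi> p ?t) + 2 * energy (\<lambda>x. scat_U \<psi> p f x - scat_U \<psi> p ?t x)"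
          by simp
      qed
      also have "\<dots> = 2 * layer energy N ?t
          + 2 * (\<integral>\<^sup>+p. energy (\<lambda>x. scat_U \<psi> p f x - scat_U \<psi> p ?t x) \<partial>count_space (paths_of_length \<Lambda> N))"
        by (simp add: nn_integral_add nn_integral_cmult layer_def)
      also have "\<dots> \<le> 2 * layer energy N ?t + 2 * energy (\<lambda>x. f x - ?t x)"
        by (intro add_left_mono mult_left_mono layer_nonexpansive f ts) simp
      finally show ?thesis .
    qed
    moreover have "(\<lambda>N. 2 * layer energy N ?t + 2 * energy (\<lambda>x. f x - ?t x)) \<longlonglongrightarrow> 2 * 0 + 2 * energy (\<lambda>x. f x - ?t x)"
      by (intro tendsto_add tendsto_const ennreal_tendsto_cmult layer_energy_tendsto_0_bounded t) simp
    ultimately have "W \<le> 2 * 0 + 2 * energy (\<lambda>x. f x - ?t x)"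
      by (intro LIMSEQ_le[OF W]) auto
    then show ?thesis by simp
  qed
  have "(\<lambda>n. 2 * energy (\<lambda>x. f x - truncate n f x)) \<longlonglongrightarrow> 2 * 0"
    by (intro ennreal_tendsto_cmult energy_truncate_error f) simp
  then have "W \<le> 2 * 0"
    using le by (intro LIMSEQ_le_const) auto
  with W show ?thesis by simp
qed

text \<open>
  The energy relation telescopes, and the remainder is the energy of the last layer.
\<close>

lemma low_pass_layers_sum:
  assumes f: "square_integrable f"
  shows "(\<Sum>N. layer (\<lambda>g. energy (conv g \<phi>)) N f) = energy f"
proof -
  let ?S = "layer (\<lambda>g. energy (conv g \<phi>))"
  have part: "(\<Sum>n<N. ?S n f) + layer energy N f = energy f" for N
  proof (induction N)
    case (Suc N)
    then show ?case using layer_energy_split[OF f, of N] by (simp add: add.assoc)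
  qed (simp add: layer_0)
  have "(\<lambda>N. (\<Sum>n<N. ?S n f) + layer energy N f) \<longlonglongrightarrow> (\<Sum>N. ?S N f) + 0"
    by (intro tendsto_add layer_energy_tendsto_0 f summable_LIMSEQ) simp
  then show ?thesis
    unfolding part by (simp add: LIMSEQ_const_iff)
qed

end

section \<open>From Lebesgue measurable to Borel measurable functions\<close>

lemma esqrt_squared [simp]: "(esqrt x)\<^sup>2 = x"
proof (cases x)
  case (real r)
  then show ?thesis by (simp add: esqrt_def ennreal_power)
qed (simp add: esqrt_def power2_eq_square)

lemma esqrt_less_top_iff: "esqrt x < \<infinity> \<longleftrightarrow> x < \<infinity>"
  by (simp add: esqrt_def less_top)

lemma esqrt_tendsto_0:
  assumes "X \<longlonglongrightarrow> 0"
  shows "(\<lambda>n. esqrt (X n)) \<longlonglongrightarrow> 0"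
proof (rule order_tendstoI)
  fix a :: ennreal assume "0 < a"
  then have "0 < a\<^sup>2" by (simp add: power2_eq_square ennreal_zero_less_mult_iff)
  with assms have "\<forall>\<^sub>F n in sequentially. X n < a\<^sup>2" by (rule order_tendstoD)
  then show "\<forall>\<^sub>F n in sequentially. esqrt (X n) < a"
  proof eventually_elim
    case (elim n)
    then show ?case
      using power_mono[of a "esqrt (X n)" 2] by (auto simp: not_less[symmetric])
  qed
qed simp

lemma L2_norm_eq_esqrt_energy: "L2_norm f = esqrt (energy f)"
  by (simp add: L2_norm_def energy_def nn_integral_completion)

definition borel_version :: "('a::euclidean_space \<Rightarrow> complex) \<Rightarrow> ('a \<Rightarrow> complex) \<Rightarrow> bool" where
  "borel_version f f' \<longleftrightarrow> f \<in> borel_measurable lebesgue \<and> f' \<in> borel_measurable borel \<and> (AE x in lborel. f x = f' x)"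

lemma borel_version_exists:
  assumes f[measurable]: "f \<in> borel_measurable lebesgue"
  obtains f' where "borel_version f f'"
proof -
  have "(\<lambda>x. Re (f x)) \<in> borel_measurable lebesgue" "(\<lambda>x. Im (f x)) \<in> borel_measurable lebesgue"
    by measurable
  from this[THEN completion_ex_borel_measurable_real] obtain u v
    where uv: "u \<in> borel_measurable lborel" "AE x in lborel. Re (f x) = u x"
      "v \<in> borel_measurable lborel" "AE x in lborel. Im (f x) = v x"
    by blast
  show thesis
  proof (rule that)
    have "AE x in lborel. f x = Complex (u x) (v x)"
      using uv(2,4) by eventually_elim (simp add: complex_eq_iff)
    moreover have "(\<lambda>x. Complex (u x) (v x)) \<in> borel_measurable borel"
      using uv(1,3) by (simp add: Complex_eq)
    ultimately show "borel_version f (\<lambda>x. Complex (u x) (v x))"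
      using f by (simp add: borel_version_def)
  qed
qed

lemma borel_version_refl:
  assumes "f \<in> borel_measurable borel"
  shows "borel_version f f"
proof -
  have "f \<in> borel_measurable lborel" using assms by simp
  then show ?thesis
    using assms by (simp add: borel_version_def measurable_completion)
qed

lemma borel_version_energy: "borel_version f f' \<Longrightarrow> energy f = energy f'"
  unfolding energy_def borel_version_def by (intro nn_integral_cong_AE) auto

lemma borel_version_integral:
  fixes F G :: "'a::euclidean_space \<Rightarrow> complex"
  assumes "F \<in> borel_measurable lebesgue" "G \<in> borel_measurable lebesgue" "AE x in lborel. F x = G x"
  shows "integral\<^sup>L lebesgue F = integral\<^sup>L lebesgue G"
  using assms by (intro integral_cong_AE AE_completion)

lemma AE_lborel_reflect:
  fixes x :: "'a::euclidean_space"
  assumes "AE y in lborel. P y"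
  shows "AE y in lborel. P (x - y)"
proof -
  obtain N where N: "{y \<in> space lborel. \<not> P y} \<subseteq> N" "emeasure lborel N = 0" "N \<in> sets lborel"
    using assms by (rule AE_E)
  have [measurable]: "N \<in> sets borel" using N(3) by simp
  have "(\<integral>\<^sup>+y. indicator N (x - y) \<partial>lborel) = (\<integral>\<^sup>+y. indicator N y \<partial>lborel)"
    using nn_integral_lborel_affine[of "indicator N" "-1" x] by simp
  also have "\<dots> = 0" using N by simp
  finally have "AE y in lborel. indicator N (x - y) = (0::ennreal)"
    by (subst (asm) nn_integral_0_iff_AE) auto
  then show ?thesis
    by eventually_elim (use N(1) in \<open>auto simp: indicator_def split: if_splits\<close>)
qed

text \<open>
  Equality holds at every point, since each value of a convolution is an integral and hence does not
  see null sets. Thus after one step of the cascade the original functions and their Borel versions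
  give identical results.
\<close>

lemma conv_borel_version:
  fixes f f' g g' :: "'a::euclidean_space \<Rightarrow> complex"
  assumes f: "borel_version f f'" and g: "borel_version g g'"
  shows "conv f g = conv f' g'"
proof
  fix x :: 'a
  have T: "(\<lambda>y. x - y) \<in> lebesgue \<rightarrow>\<^sub>M lebesgue"
    using lebesgue_affine_measurable[of "\<lambda>_. -1" x] by (simp add: sum_negf euclidean_representation)
  have m: "f \<in> borel_measurable lebesgue" "g \<in> borel_measurable lebesgue"
    "f' \<in> borel_measurable lebesgue" "g' \<in> borel_measurable lebesgue"
    using f g by (auto simp: borel_version_def intro: measurable_completion)
  have "AE y in lborel. f y = f' y" "AE y in lborel. g (x - y) = g' (x - y)"
    using f AE_lborel_reflect[of "\<lambda>y. g y = g' y" x] g by (auto simp: borel_version_def)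
  then have "AE y in lborel. f y * g (x - y) = f' y * g' (x - y)"
    by eventually_elim simp
  then show "conv f g x = conv f' g' x"
    unfolding conv_def
    by (intro borel_version_integral borel_measurable_times m measurable_compose[OF T])
qed

lemma fourier_borel_version:
  fixes f f' :: "'a::euclidean_space \<Rightarrow> complex"
  assumes f: "borel_version f f'"
  shows "fourier f = fourier f'"
proof
  fix \<xi> :: 'a
  have [measurable]: "f \<in> borel_measurable lebesgue" "f' \<in> borel_measurable lebesgue"
    using f by (auto simp: borel_version_def intro: measurable_completion)
  have "(\<lambda>x. character \<xi> x) \<in> borel_measurable lborel" by measurable
  then have [measurable]: "(\<lambda>x. character \<xi> x) \<in> borel_measurable lebesgue" by (rule measurable_completion)
  have "AE x in lborel. f x = f' x" using f by (simp add: borel_version_def)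
  then have "AE x in lborel. f x * character \<xi> x = f' x * character \<xi> x"
    by eventually_elim simp
  then show "fourier f \<xi> = fourier f' \<xi>"
    unfolding fourier_def character_def[symmetric] by (intro borel_version_integral) measurable
qed

lemma borel_version_integrable:
  assumes f: "borel_version f f'" and "integrable lebesgue f"
  shows "integrable lborel f'"
proof -
  have m: "f' \<in> borel_measurable lborel" using f by (simp add: borel_version_def)
  have "integrable lebesgue f'"
    using assms(2) f measurable_completion[OF m]
    by (subst integrable_cong_AE[of _ _ f]) (auto simp: borel_version_def intro!: AE_completion)
  then show ?thesis using m by (simp add: integrable_completion)
qed

lemma borel_version_scat_U:
  assumes "borel_version f f'" "set p \<subseteq> \<Lambda>" "\<And>l. l \<in> \<Lambda> \<Longrightarrow> borel_version (\<psi> l) (\<psi>' l)"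
  shows "borel_version (scat_U \<psi> p f) (scat_U \<psi>' p f')"
  using assms(1,2)
proof (induction p arbitrary: f f')
  case (Cons l p)
  then have l: "borel_version (\<psi> l) (\<psi>' l)" by (intro assms(3)) simp
  have [measurable]: "conv f' (\<psi>' l) \<in> borel_measurable borel"
    using Cons.prems(1) l by (intro conv_measurable) (auto simp: borel_version_def)
  have "scat_U1 \<psi>' l f' \<in> borel_measurable borel"
    unfolding scat_U1_def by measurable
  moreover have "scat_U1 \<psi> l f = scat_U1 \<psi>' l f'"
    unfolding scat_U1_def conv_borel_version[OF Cons.prems(1) l] ..
  ultimately have "borel_version (scat_U1 \<psi> l f) (scat_U1 \<psi>' l f')"
    using borel_version_refl by metis
  from Cons.IH[OF this] Cons.prems(2) show ?case by simp
qed simp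

lemma infsum_all_paths:
  fixes F :: "'l list \<Rightarrow> ennreal"
  assumes \<Lambda>: "countable \<Lambda>"
  shows "(\<Sum>\<^sub>\<infinity>p\<in>all_paths \<Lambda>. F p) = (\<Sum>n. \<Sum>\<^sub>\<infinity>p\<in>paths_of_length \<Lambda> n. F p)"
proof -
  let ?P = "paths_of_length \<Lambda>"
  have cP: "countable (?P n)" for n by (rule countable_paths[OF \<Lambda>])
  have cA: "countable (all_paths \<Lambda>)" unfolding all_paths_def by (intro countable_UN cP) simp
  have dis: "disjoint_family ?P" by (auto simp: disjoint_family_on_def paths_of_length_def)
  have "(\<Sum>\<^sub>\<infinity>p\<in>all_paths \<Lambda>. F p) = (\<integral>\<^sup>+p. F p \<partial>count_space (all_paths \<Lambda>))"
    by (rule infsum_ennreal_eq_nn_integral[OF cA])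
  also have "\<dots> = (\<integral>\<^sup>+p. (\<Sum>n. F p * indicator (?P n) p) \<partial>count_space (all_paths \<Lambda>))"
  proof (rule nn_integral_cong)
    fix p assume "p \<in> space (count_space (all_paths \<Lambda>))"
    then obtain n where "p \<in> ?P n" by (auto simp: all_paths_def)
    from suminf_cmult_indicator[OF dis this, of "\<lambda>_. F p"]
    show "F p = (\<Sum>n. F p * indicator (?P n) p)" by simp
  qed
  also have "\<dots> = (\<Sum>n. \<integral>\<^sup>+p. F p * indicator (?P n) p \<partial>count_space (all_paths \<Lambda>))"
    by (rule nn_integral_suminf) simp
  also have "\<dots> = (\<Sum>n. \<Sum>\<^sub>\<infinity>p\<in>?P n. F p)"
  proof (rule suminf_cong)
    fix n
    have "?P n \<subseteq> all_paths \<Lambda>" by (auto simp: all_paths_def)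
    then have "(\<integral>\<^sup>+p. F p * indicator (?P n) p \<partial>count_space (all_paths \<Lambda>)) = (\<integral>\<^sup>+p. F p \<partial>count_space (?P n))"
      by (simp add: nn_integral_count_space_indicator) (auto intro!: nn_integral_cong simp: indicator_def)
    then show "(\<integral>\<^sup>+p. F p * indicator (?P n) p \<partial>count_space (all_paths \<Lambda>)) = (\<Sum>\<^sub>\<infinity>p\<in>?P n. F p)"
      by (simp add: infsum_ennreal_eq_nn_integral[OF cP])
  qed
  finally show ?thesis .
qed

theorem theorem1p4:
  fixes \<phi> :: "'a::euclidean_space \<Rightarrow> complex"
    and \<Lambda> :: "'l set"
    and \<psi> :: "'l \<Rightarrow> 'a \<Rightarrow> complex"
  assumes "scattering_filter_bank \<phi> \<Lambda> \<psi>"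
  shows "admissible \<Lambda> \<psi> \<and>
    (\<forall>f\<in>L2.
       (\<lambda>p. scat_S \<phi> \<psi> p f) \<in> ell2 (all_paths \<Lambda>) \<and>
       (ell2_norm (all_paths \<Lambda>) (\<lambda>p. scat_S \<phi> \<psi> p f))\<^sup>2
         = (\<Sum>n. \<Sum>\<^sub>\<infinity>p\<in>paths_of_length \<Lambda> n. (L2_norm (scat_S \<phi> \<psi> p f))\<^sup>2) \<and>
       (\<Sum>n. \<Sum>\<^sub>\<infinity>p\<in>paths_of_length \<Lambda> n. (L2_norm (scat_S \<phi> \<psi> p f))\<^sup>2) = (L2_norm f)\<^sup>2) \<and>
    norm_preserving \<phi> \<Lambda> \<psi>"
proof -
  have \<Lambda>: "countable \<Lambda>" and low: "fourier \<phi> 0 \<noteq> 0"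
    and \<phi>: "integrable lebesgue \<phi>" "energy \<phi> < \<infinity>"
    and \<psi>: "\<And>l. l \<in> \<Lambda> \<Longrightarrow> integrable lebesgue (\<psi> l)" "\<And>l. l \<in> \<Lambda> \<Longrightarrow> energy (\<psi> l) < \<infinity>"
    and tight: "AE \<xi> in lborel. ennreal ((cmod (fourier \<phi> \<xi>))\<^sup>2)
      + (\<integral>\<^sup>+l. ennreal ((cmod (fourier (\<psi> l) \<xi>))\<^sup>2) \<partial>count_space \<Lambda>) = 1"
    using assms
    by (auto simp: scattering_filter_bank_def L1_def L2_def L2_norm_eq_esqrt_energy esqrt_less_top_iff[unfolded infinity_ennreal_def]
        infsum_ennreal_eq_nn_integral AE_completion_iff)
  obtain \<phi>' where \<phi>': "borel_version \<phi> \<phi>'"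
    using borel_version_exists[OF borel_measurable_integrable[OF \<phi>(1)]] .
  have "\<exists>g. borel_version (\<psi> l) g" if "l \<in> \<Lambda>" for l
    using borel_version_exists[OF borel_measurable_integrable[OF \<psi>(1)[OF that]]] by blast
  then obtain \<psi>' where \<psi>': "\<And>l. l \<in> \<Lambda> \<Longrightarrow> borel_version (\<psi> l) (\<psi>' l)" by metis
  interpret borel_filter_bank \<phi>' \<Lambda> \<psi>'
  proof
    show "AE \<xi> in lborel. ennreal ((cmod (fourier \<phi>' \<xi>))\<^sup>2)
      + (\<integral>\<^sup>+l. ennreal ((cmod (fourier (\<psi>' l) \<xi>))\<^sup>2) \<partial>count_space \<Lambda>) = 1"
      using tight
    proof eventually_elim
      case (elim \<xi>)
      have "(\<integral>\<^sup>+l. ennreal ((cmod (fourier (\<psi>' l) \<xi>))\<^sup>2) \<partial>count_space \<Lambda>)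
          = (\<integral>\<^sup>+l. ennreal ((cmod (fourier (\<psi> l) \<xi>))\<^sup>2) \<partial>count_space \<Lambda>)"
        by (intro nn_integral_cong) (simp add: fourier_borel_version[OF \<psi>'])
      then show ?case using elim by (simp add: fourier_borel_version[OF \<phi>'])
    qed
  qed (use \<Lambda> low \<phi> \<psi> in \<open>auto simp: fourier_borel_version[OF \<phi>'] borel_version_energy[OF \<phi>', symmetric]
        borel_version_energy[OF \<psi>', symmetric] intro: borel_version_integrable[OF \<phi>'] borel_version_integrable[OF \<psi>']\<close>)
  have main: "(\<lambda>N. ell2_norm (paths_of_length \<Lambda> N) (\<lambda>p. scat_U \<psi> p f)) \<longlonglongrightarrow> 0"
    "\<And>p. p \<in> all_paths \<Lambda> \<Longrightarrow> scat_S \<phi> \<psi> p f \<in> L2"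
    "(\<Sum>n. \<Sum>\<^sub>\<infinity>p\<in>paths_of_length \<Lambda> n. (L2_norm (scat_S \<phi> \<psi> p f))\<^sup>2) = (L2_norm f)\<^sup>2"
    if f: "f \<in> L2" for f
  proof -
    obtain f' where f': "borel_version f f'"
      using f borel_version_exists[of f] by (auto simp: L2_def)
    have fs: "square_integrable f'"
      using f f' borel_version_energy[OF f']
      by (auto simp: L2_def square_integrable_def borel_version_def L2_norm_eq_esqrt_energy esqrt_less_top_iff[unfolded infinity_ennreal_def])
    have U: "borel_version (scat_U \<psi> p f) (scat_U \<psi>' p f')" if "set p \<subseteq> \<Lambda>" for p
      by (rule borel_version_scat_U[OF f' that \<psi>'])
    have S: "scat_S \<phi> \<psi> p f = conv (scat_U \<psi>' p f') \<phi>'" if "set p \<subseteq> \<Lambda>" for p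
      unfolding scat_S_def by (rule conv_borel_version[OF U[OF that] \<phi>'])
    have "ell2_norm (paths_of_length \<Lambda> N) (\<lambda>p. scat_U \<psi> p f) = esqrt (layer energy N f')" for N
      unfolding ell2_norm_def layer_def L2_norm_eq_esqrt_energy esqrt_squared
        infsum_ennreal_eq_nn_integral[OF countable_paths[OF \<Lambda>]]
      by (intro arg_cong[where f=esqrt] nn_integral_cong borel_version_energy U) (simp add: paths_of_length_def)
    then show "(\<lambda>N. ell2_norm (paths_of_length \<Lambda> N) (\<lambda>p. scat_U \<psi> p f)) \<longlonglongrightarrow> 0"
      using esqrt_tendsto_0[OF layer_energy_tendsto_0[OF fs]] by simp
    show "scat_S \<phi> \<psi> p f \<in> L2" if "p \<in> all_paths \<Lambda>" for p
    proof -
      have p: "set p \<subseteq> \<Lambda>" using that by (auto simp: all_paths_def paths_of_length_def)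
      have g: "square_integrable (scat_U \<psi>' p f')" by (rule square_integrable_scat_U[OF fs p])
      have "energy (conv (scat_U \<psi>' p f') \<phi>') \<le> energy (scat_U \<psi>' p f')"
        using one_step_energy_le[OF g] by (auto simp: one_step_energy_def intro: order_trans[rotated])
      then have "energy (scat_S \<phi> \<psi> p f) < \<infinity>"
        unfolding S[OF p] using square_integrableD(2)[OF g] by (rule le_less_trans)
      moreover have "scat_S \<phi> \<psi> p f \<in> borel_measurable lebesgue"
        unfolding S[OF p] using borel_version_refl[OF conv_\<phi>_measurable[OF g]] by (simp add: borel_version_def)
      ultimately show ?thesis
        unfolding L2_def mem_Collect_eq L2_norm_eq_esqrt_energy esqrt_less_top_iff by blast
    qed
    have "(\<Sum>\<^sub>\<infinity>p\<in>paths_of_length \<Lambda> n. (L2_norm (scat_S \<phi> \<psi> p f))\<^sup>2) = layer (\<lambda>g. energy (conv g \<phi>')) n f'" for n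
      unfolding layer_def L2_norm_eq_esqrt_energy esqrt_squared infsum_ennreal_eq_nn_integral[OF countable_paths[OF \<Lambda>]]
      by (intro nn_integral_cong) (simp add: paths_of_length_def S)
    then show "(\<Sum>n. \<Sum>\<^sub>\<infinity>p\<in>paths_of_length \<Lambda> n. (L2_norm (scat_S \<phi> \<psi> p f))\<^sup>2) = (L2_norm f)\<^sup>2"
      by (simp add: low_pass_layers_sum[OF fs] L2_norm_eq_esqrt_energy borel_version_energy[OF f'])
  qed
  have sq: "(ell2_norm (all_paths \<Lambda>) (\<lambda>p. scat_S \<phi> \<psi> p f))\<^sup>2
      = (\<Sum>n. \<Sum>\<^sub>\<infinity>p\<in>paths_of_length \<Lambda> n. (L2_norm (scat_S \<phi> \<psi> p f))\<^sup>2)" for f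
    by (simp add: ell2_norm_def infsum_all_paths[OF \<Lambda>])
  have norm: "ell2_norm (all_paths \<Lambda>) (\<lambda>p. scat_S \<phi> \<psi> p f) = L2_norm f" if "f \<in> L2" for f
    using main(3)[OF that] by (simp add: ell2_norm_def infsum_all_paths[OF \<Lambda>] L2_norm_eq_esqrt_energy)
  have "(\<lambda>p. scat_S \<phi> \<psi> p f) \<in> ell2 (all_paths \<Lambda>)" if "f \<in> L2" for f
    using main(2)[OF that] that unfolding ell2_def mem_Collect_eq norm[OF that] by (auto simp: L2_def)
  then show ?thesis
    unfolding admissible_def norm_preserving_def using main sq norm by blast
qed

end
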